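(* Let $G$ be a group with normal subgroup $N$. Let $X$ be a finite symmetric generating set for $G$. Let $S=\{w\in X^* \mid \overline{w}\in N\}$. Suppose that \begin{itemize} \item $G/N$ has a logspace normal form; and \item there is a logspace computable function $f:S\to S$ such that $\overline{f(w)}=\overline{w}$ for all $w\in S$, and, for all $w_1,w_2\in S$, $f(w_1)=f(w_2)$ if and only if $\overline{w_1}=\overline{w_2}$. \end{itemize} Then $G$ has a logspace normal form.
   Context: The subgroup $N$ is not assumed finitely generated. A deterministic logspace transducer is a deterministic machine with a finite state control and three tapes: a read-only input tape storing the input word; a read-write work tape restricted to at most $c\log n$ squares, where $n$ is the length of the input word and $c$ is a fixed constant; and a write-only output tape written from left to right. In each transition it may modify the work tape, change state, move the input read-head, and write at most a fixed constant number of letters to the output tape. For finite alphabets $X,Y$, a function $f:X^*\to Y^*$ is logspace computable if some deterministic logspace transducer outputs $f(w)$ on every input $w\in X^*$ ($X^*$ is the set of finite words over $X$, including the empty word $\lambda$); for a function defined only on a subset $S\subseteq X^*$, the transducer is required to output $f(w)$ on every input $w\in S$. Let $G$ be a group with finite symmetric (closed under inverses) generating set $X$; for $w\in X^*$ let $\overline{w}\in G$ denote the element it represents. A normal form for $(G,X)$ is a subset $L\subseteq X^*$ such that $w\mapsto\overline{w}$ restricts to a bijection $L\to G$. A logspace normal form function for $(G,X)$ is a logspace computable $f:X^*\to X^*$ such that, for some normal form $L$, $f(w)$ is the unique element of $L$ with $\overline{f(w)}=\overline{w}$, for all $w\in X^*$. $(G,X)$ has a logspace normal form if it has a logspace normal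 form function; $G$ has a logspace normal form if $(G,X)$ does for some finite symmetric generating set $X$. *)

theory Defs
  imports "HOL-Algebra.Generated_Groups" Complex_Main
begin

section \<open>Deterministic logspace transducers\<close>

text \<open>
  The input word is stored between two end markers, so that the machine can detect both ends
  of its input.
\<close>

datatype 'x input_symbol = LeftEnd | Letter 'x | RightEnd

datatype move = MoveLeft | Stay | MoveRight

text \<open>
  A transition depends on the control state, the scanned input symbol and the scanned work tape
  symbol. It yields the new state, the symbol written on the work tape, the moves of the input
  head and of the work head, and the word appended to the output tape. The machine halts when
  no transition is given.
\<close>

record ('q, 'g, 'x, 'y) transducer =
  states :: "'q set"
  init :: 'q
  work_alphabet :: "'g set"
  blank :: 'g
  trans :: "'q \<Rightarrow> 'x input_symbol \<Rightarrow> 'g \<Rightarrow> ('q \<times> 'g \<times> move \<times> move \<times> 'y list) option"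

definition wf_transducer ::
    "'x set \<Rightarrow> 'y set \<Rightarrow> ('q, 'g, 'x, 'y) transducer \<Rightarrow> bool" where
  "wf_transducer X Y M \<longleftrightarrow>
     finite X \<and> finite Y \<and>
     finite (states M) \<and> init M \<in> states M \<and>
     finite (work_alphabet M) \<and> blank M \<in> work_alphabet M \<and>
     (\<exists>b::nat. \<forall>q \<in> states M. \<forall>s \<in> {LeftEnd, RightEnd} \<union> Letter ` X. \<forall>g \<in> work_alphabet M.
        \<forall>q' g' mi mw u. trans M q s g = Some (q', g', mi, mw, u) \<longrightarrow>
          q' \<in> states M \<and> g' \<in> work_alphabet M \<and> u \<in> lists Y \<and> length u \<le> b)"

record ('q, 'g, 'y) config =
  state :: 'q
  input_pos :: nat
  work_tape :: "nat \<Rightarrow> 'g"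
  work_pos :: nat
  out_tape :: "'y list"

definition init_config :: "('q, 'g, 'x, 'y) transducer \<Rightarrow> ('q, 'g, 'y) config" where
  "init_config M =
     \<lparr>state = init M, input_pos = 0, work_tape = (\<lambda>_. blank M), work_pos = 0, out_tape = []\<rparr>"

definition scanned_input :: "'x list \<Rightarrow> nat \<Rightarrow> 'x input_symbol" where
  "scanned_input w i =
     (if i = 0 then LeftEnd else if i \<le> length w then Letter (w ! (i - 1)) else RightEnd)"

text \<open>Truncated subtraction on the naturals keeps a head on the leftmost square of its tape.\<close>

fun move_head :: "move \<Rightarrow> nat \<Rightarrow> nat" where
  "move_head MoveLeft i = i - 1"
| "move_head Stay i = i"
| "move_head MoveRight i = Suc i"

definition current_trans ::
    "('q, 'g, 'x, 'y) transducer \<Rightarrow> 'x list \<Rightarrow> ('q, 'g, 'y) config \<Rightarrow>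
     ('q \<times> 'g \<times> move \<times> move \<times> 'y list) option" where
  "current_trans M w c =
     trans M (state c) (scanned_input w (input_pos c)) (work_tape c (work_pos c))"

text \<open>
  The input head cannot move past the right end marker: otherwise its position would be an
  unbounded counter not accounted for in the space bound.
\<close>

definition step ::
    "('q, 'g, 'x, 'y) transducer \<Rightarrow> 'x list \<Rightarrow> ('q, 'g, 'y) config \<Rightarrow> ('q, 'g, 'y) config \<Rightarrow> bool"
  where
  "step M w c c' \<longleftrightarrow>
     (\<exists>q g mi mw u. current_trans M w c = Some (q, g, mi, mw, u) \<and>
        c' = \<lparr>state = q,
              input_pos = min (length w + 1) (move_head mi (input_pos c)),
              work_tape = (work_tape c)(work_pos c := g),
              work_pos = move_head mw (work_pos c),
              out_tape = out_tape c @ u\<rparr>)"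

definition reachable ::
    "('q, 'g, 'x, 'y) transducer \<Rightarrow> 'x list \<Rightarrow> ('q, 'g, 'y) config \<Rightarrow> bool" where
  "reachable M w c \<longleftrightarrow> (step M w)\<^sup>*\<^sup>* (init_config M) c"

definition outputs :: "('q, 'g, 'x, 'y) transducer \<Rightarrow> 'x list \<Rightarrow> 'y list \<Rightarrow> bool" where
  "outputs M w v \<longleftrightarrow> (\<exists>c. reachable M w c \<and> current_trans M w c = None \<and> out_tape c = v)"

text \<open>
  The logarithm is taken of \<open>n + 2\<close> rather than of the input length \<open>n\<close>, so that the bound is
  positive for inputs of length 0 and 1 as well; for \<open>n \<ge> 2\<close> the two differ by at most a
  constant factor. The bound is imposed on all words over the input alphabet.
\<close>

definition logspace_transducer ::
    "'x set \<Rightarrow> 'y set \<Rightarrow> ('q, 'g, 'x, 'y) transducer \<Rightarrow> bool" where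
  "logspace_transducer X Y M \<longleftrightarrow>
     wf_transducer X Y M \<and>
     (\<exists>\<kappa>::real. \<forall>w \<in> lists X. \<forall>c. reachable M w c \<longrightarrow>
        real (work_pos c + 1) \<le> \<kappa> * log 2 (real (length w + 2)))"

text \<open>
  Computability of a function from \<open>S \<subseteq> X\<^sup>*\<close> to \<open>Y\<^sup>*\<close>. As states and work tape symbols
  range over finite sets, it is no restriction to take them to be natural numbers.
\<close>

definition logspace_computable ::
    "'x set \<Rightarrow> 'y set \<Rightarrow> 'x list set \<Rightarrow> ('x list \<Rightarrow> 'y list) \<Rightarrow> bool" where
  "logspace_computable X Y S f \<longleftrightarrow>
     finite X \<and> finite Y \<and> S \<subseteq> lists X \<and> f \<in> S \<rightarrow> lists Y \<and>
     (\<exists>M :: (nat, nat, 'x, 'y) transducer.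
        logspace_transducer X Y M \<and> (\<forall>w \<in> S. outputs M w (f w)))"


section \<open>Logspace normal forms of groups\<close>

definition finite_symmetric_generating_set :: "('a, 'b) monoid_scheme \<Rightarrow> 'a set \<Rightarrow> bool" where
  "finite_symmetric_generating_set G X \<longleftrightarrow>
     finite X \<and> X \<subseteq> carrier G \<and> (\<forall>x \<in> X. inv\<^bsub>G\<^esub> x \<in> X) \<and> generate G X = carrier G"

definition word_eval :: "('a, 'b) monoid_scheme \<Rightarrow> 'a list \<Rightarrow> 'a" where
  "word_eval G w = foldr (\<otimes>\<^bsub>G\<^esub>) w \<one>\<^bsub>G\<^esub>"

definition normal_form :: "('a, 'b) monoid_scheme \<Rightarrow> 'a set \<Rightarrow> 'a list set \<Rightarrow> bool" where
  "normal_form G X L \<longleftrightarrow> L \<subseteq> lists X \<and> bij_betw (word_eval G) L (carrier G)"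

definition logspace_normal_form_function ::
    "('a, 'b) monoid_scheme \<Rightarrow> 'a set \<Rightarrow> ('a list \<Rightarrow> 'a list) \<Rightarrow> bool" where
  "logspace_normal_form_function G X f \<longleftrightarrow>
     logspace_computable X X (lists X) f \<and>
     (\<exists>L. normal_form G X L \<and>
        (\<forall>w \<in> lists X. f w \<in> L \<and> word_eval G (f w) = word_eval G w))"

definition has_logspace_normal_form :: "('a, 'b) monoid_scheme \<Rightarrow> bool" where
  "has_logspace_normal_form G \<longleftrightarrow>
     (\<exists>X f. finite_symmetric_generating_set G X \<and> logspace_normal_form_function G X f)"

end

theory Submission
  imports Defs
begin

text \<open>
  Let \<open>q\<close> be a logspace normal form function of \<open>G/N\<close> over a generating set \<open>Y\<close>. Choose for each
  \<open>x \<in> X\<close> a word over \<open>Y\<close> that represents the coset of \<open>x\<close>, and for each \<open>y \<in> Y\<close> a word over \<open>X\<close> that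
  represents an element of the coset \<open>y\<close>. Translating \<open>w \<in> X\<^sup>*\<close> to \<open>Y\<^sup>*\<close>, applying \<open>q\<close> and translating
  back yields a word \<open>t(w)\<close> over \<open>X\<close> that depends only on the coset of \<open>w\<close> and represents an
  element of this coset. The word \<open>w t(w)\<^sup>-\<^sup>1\<close> lies in \<open>S\<close>, where the inverse is taken letter by letter
  in reverse order, and so
    \<open>g(w) = f(w t(w)\<^sup>-\<^sup>1) t(w)\<close>
  is defined and represents the same element as \<open>w\<close>. If \<open>v\<close> and \<open>w\<close> represent the same element, then
  \<open>t(v) = t(w)\<close>, the words to which \<open>f\<close> is applied represent the same element of \<open>N\<close>, and \<open>g(v) = g(w)\<close>.
  Hence the range of \<open>g\<close> is a normal form.

  It remains to see that \<open>g\<close> is logspace computable. It arises from \<open>q\<close> and \<open>f\<close> by homomorphisms, reversal,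
  concatenation and composition. Composition is the difficult part, as intermediate words do not fit
  on the work tape: their letters are recomputed whenever they are read, and only positions in these
  words are stored. These have logarithmically many bits, because an output of a logspace transducer
  is of polynomial length.

  To avoid programming with tapes, the construction is carried out for counter programs. Their
  registers hold numbers bounded by a polynomial in the length of the input, and they read the
  input at a position given by a register; for them, composition is the replacement of each
  reading instruction by a run of the inner program (\<open>while_computable_comp\<close>). A logspace transducer
  is simulated by such a program, with the work tape coded as two numbers
  (\<open>logspace_imp_while_computable\<close>), and a program is executed by a logspace transducer that keeps the
  registers in binary (\<open>while_imp_logspace_computable\<close>).

  The transducer for \<open>f\<close> need not halt outside \<open>S\<close>, whereas \<open>g\<close> is defined on all words. This causes no
  difficulty because \<open>f\<close> is applied to words in \<open>S\<close> only.
\<close>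

section \<open>Counter programs\<close>

text \<open>
  A program works on registers that hold natural numbers, and reads the letter of the input word
  whose position is the value of a register. Reading clears that register, because a transducer
  finds the position by counting the register down while its input head advances; a position that
  is still needed has to be copied first.
\<close>

datatype ('x, 'y) com =
    Skip
  | Inc nat
  | Dec nat
  | Out 'y
  | Seq "('x, 'y) com" "('x, 'y) com" (infixr ";;" 60)
  | Cond nat "('x, 'y) com" "('x, 'y) com"
  | While nat "('x, 'y) com"
  | Read nat "'x input_symbol \<Rightarrow> ('x, 'y) com"

text \<open>
  \<open>exec B w c s u t\<close>: on input \<open>w\<close>, the program \<open>c\<close> leads from store \<open>s\<close> to store \<open>t\<close> and outputs
  \<open>u\<close>, and no increment ever produces a value outside \<open>{..<B}\<close>. If \<open>B\<close> is polynomial in the length of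
  \<open>w\<close>, a register thus fits into logarithmically many bits. Only terminating runs are described:
  the program that is finally turned into a transducer terminates on every word.
\<close>

inductive exec :: "nat \<Rightarrow> 'x list \<Rightarrow> ('x, 'y) com \<Rightarrow> (nat \<Rightarrow> nat) \<Rightarrow> 'y list \<Rightarrow> (nat \<Rightarrow> nat) \<Rightarrow> bool"
  for B :: nat and w :: "'x list" where
  Skip: "exec B w Skip s [] s"
| Inc: "Suc (s r) < B \<Longrightarrow> exec B w (Inc r) s [] (s(r := Suc (s r)))"
| Dec: "s r = Suc k \<Longrightarrow> exec B w (Dec r) s [] (s(r := k))"
| Out: "exec B w (Out y) s [y] s"
| Seq: "exec B w c1 s u s' \<Longrightarrow> exec B w c2 s' v t \<Longrightarrow> exec B w (c1 ;; c2) s (u @ v) t"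
| CondT: "s r > 0 \<Longrightarrow> exec B w c1 s u t \<Longrightarrow> exec B w (Cond r c1 c2) s u t"
| CondF: "s r = 0 \<Longrightarrow> exec B w c2 s u t \<Longrightarrow> exec B w (Cond r c1 c2) s u t"
| WhileF: "s r = 0 \<Longrightarrow> exec B w (While r c) s [] s"
| WhileT: "s r > 0 \<Longrightarrow> exec B w c s u s' \<Longrightarrow> exec B w (While r c) s' v t \<Longrightarrow>
    exec B w (While r c) s (u @ v) t"
| Read: "exec B w (F (scanned_input w (s r))) (s(r := 0)) u t \<Longrightarrow> exec B w (Read r F) s u t"

definition input_symbols :: "'x set \<Rightarrow> 'x input_symbol set" where
  "input_symbols X = {LeftEnd, RightEnd} \<union> Letter ` X"

lemma finite_input_symbols [simp]: "finite (input_symbols X) \<longleftrightarrow> finite X"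
  by (auto simp: input_symbols_def finite_image_iff inj_on_def)

lemma scanned_input_in_input_symbols: "w \<in> lists X \<Longrightarrow> scanned_input w i \<in> input_symbols X"
  by (auto simp: scanned_input_def input_symbols_def in_lists_conv_set)

primrec wf_com :: "'x set \<Rightarrow> 'y set \<Rightarrow> nat \<Rightarrow> ('x, 'y) com \<Rightarrow> bool" where
  "wf_com X Y K Skip \<longleftrightarrow> True"
| "wf_com X Y K (Inc r) \<longleftrightarrow> r < K"
| "wf_com X Y K (Dec r) \<longleftrightarrow> r < K"
| "wf_com X Y K (Out y) \<longleftrightarrow> y \<in> Y"
| "wf_com X Y K (c1 ;; c2) \<longleftrightarrow> wf_com X Y K c1 \<and> wf_com X Y K c2"
| "wf_com X Y K (Cond r c1 c2) \<longleftrightarrow> r < K \<and> wf_com X Y K c1 \<and> wf_com X Y K c2"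
| "wf_com X Y K (While r c) \<longleftrightarrow> r < K \<and> wf_com X Y K c"
| "wf_com X Y K (Read r F) \<longleftrightarrow> r < K \<and> (\<forall>a \<in> input_symbols X. wf_com X Y K (F a))"

lemma exec_mono: "exec B w c s u t \<Longrightarrow> B \<le> B' \<Longrightarrow> exec B' w c s u t"
  by (induction rule: exec.induct) (auto intro: exec.intros)

lemma wf_com_mono: "wf_com X Y K c \<Longrightarrow> K \<le> K' \<Longrightarrow> wf_com X Y K' c"
  by (induction c) (auto)

lemma exec_frame:
  "exec B w c s u t \<Longrightarrow> wf_com X Y K c \<Longrightarrow> w \<in> lists X \<Longrightarrow> K \<le> r \<Longrightarrow> t r = s r"
  by (induction rule: exec.induct) (auto simp: scanned_input_in_input_symbols)

text \<open>
  The length bound on the output makes the notion closed under composition: it bounds the input of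
  the program that is run on the output.
\<close>

definition while_computable ::
    "'x set \<Rightarrow> 'y set \<Rightarrow> 'x list set \<Rightarrow> ('x list \<Rightarrow> 'y list) \<Rightarrow> bool" where
  "while_computable X Y S f \<longleftrightarrow>
     finite X \<and> finite Y \<and> S \<subseteq> lists X \<and> f \<in> S \<rightarrow> lists Y \<and>
     (\<exists>c K d. wf_com X Y K c \<and>
        (\<forall>w \<in> S. length (f w) \<le> (length w + 2) ^ d \<and>
           (\<exists>t. exec ((length w + 2) ^ d) w c (\<lambda>_. 0) (f w) t)))"

section \<open>Basic programs\<close>

lemma exec_Seq:
  "exec B w c1 s u s' \<Longrightarrow> exec B w c2 s' v t \<Longrightarrow> uv = u @ v \<Longrightarrow> exec B w (c1 ;; c2) s uv t"
  by (auto intro: exec.Seq)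

lemma exec_Inc: "Suc (s r) < B \<Longrightarrow> t = s(r := Suc (s r)) \<Longrightarrow> exec B w (Inc r) s [] t"
  by (auto intro: exec.Inc)

lemma exec_Dec: "s r = Suc k \<Longrightarrow> t = s(r := k) \<Longrightarrow> exec B w (Dec r) s [] t"
  by (auto intro: exec.Dec)

lemma exec_Inc_Seq:
  "Suc (s r) < B \<Longrightarrow> exec B w c (s(r := Suc (s r))) u t \<Longrightarrow> exec B w (Inc r ;; c) s u t"
  using exec_Seq[OF exec.Inc] by fastforce

lemma exec_Dec_Seq:
  "s r = Suc k \<Longrightarrow> exec B w c (s(r := k)) u t \<Longrightarrow> exec B w (Dec r ;; c) s u t"
  using exec_Seq[OF exec.Dec] by fastforce

primrec incs :: "nat \<Rightarrow> nat \<Rightarrow> ('x, 'y) com" where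
  "incs r 0 = Skip"
| "incs r (Suc k) = Inc r ;; incs r k"

lemma exec_incs:
  fixes w :: "'x list"
  shows "s r + k < B \<Longrightarrow> t = s(r := s r + k) \<Longrightarrow>
    exec B w (incs r k :: ('x, 'y) com) s [] t"
proof (induction k arbitrary: s)
  case (Suc k)
  have "exec B w (incs r k :: ('x, 'y) com) (s(r := Suc (s r))) [] t"
    using Suc.prems by (intro Suc.IH) auto
  then show ?case
    using Suc.prems by (simp add: exec_Inc_Seq)
qed (auto intro: exec.Skip)

lemma wf_incs [simp]: "r < K \<Longrightarrow> wf_com X Y K (incs r k)"
  by (induction k) auto

primrec outs :: "'y list \<Rightarrow> ('x, 'y) com" where
  "outs [] = Skip"
| "outs (y # ys) = Out y ;; outs ys"

lemma exec_outs: "exec B w (outs ys) s ys s"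
  by (induction ys) (auto intro!: exec_Seq exec.Skip exec.Out)

lemma wf_outs [simp]: "wf_com X Y K (outs ys) \<longleftrightarrow> ys \<in> lists Y"
  by (induction ys) auto

text \<open>
  A loop that decrements \<open>r\<close> first is a for loop: its body runs as often as the initial value of
  \<open>r\<close> says, provided that it leaves \<open>r\<close> alone. The store \<open>I i\<close> is the loop invariant after \<open>i\<close>
  rounds, up to its value at \<open>r\<close>, where the number of rounds to come is filled in.
\<close>

lemma exec_for_invariant:
  fixes I :: "nat \<Rightarrow> nat \<Rightarrow> nat"
  assumes "\<And>i. i < k \<Longrightarrow> exec B w c ((I i)(r := k - 1 - i)) [] ((I (Suc i))(r := k - 1 - i))"
  shows "exec B w (While r (Dec r ;; c)) ((I 0)(r := k)) [] ((I k)(r := 0))"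
  using assms
proof (induction k arbitrary: I)
  case 0
  then show ?case by (auto intro: exec.WhileF)
next
  case (Suc k)
  have "exec B w c ((I 0)(r := Suc k - 1 - 0)) [] ((I (Suc 0))(r := Suc k - 1 - 0))"
    by (rule Suc.prems) simp
  then have first: "exec B w (Dec r ;; c) ((I 0)(r := Suc k)) [] ((I (Suc 0))(r := k))"
    by (intro exec_Dec_Seq[where k = k]) simp_all
  have rest: "exec B w (While r (Dec r ;; c)) ((I (Suc 0))(r := k)) [] ((I (Suc k))(r := 0))"
  proof (rule Suc.IH[where I = "\<lambda>i. I (Suc i)"])
    fix i assume "i < k"
    then have "exec B w c ((I (Suc i))(r := Suc k - 1 - Suc i)) []
        ((I (Suc (Suc i)))(r := Suc k - 1 - Suc i))"
      by (intro Suc.prems) simp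
    then show "exec B w c ((I (Suc i))(r := k - 1 - i)) [] ((I (Suc (Suc i)))(r := k - 1 - i))"
      by simp
  qed
  have "exec B w (While r (Dec r ;; c)) ((I 0)(r := Suc k)) ([] @ []) ((I (Suc k))(r := 0))"
    by (rule exec.WhileT[OF _ first rest]) simp
  then show ?case unfolding append_Nil2 .
qed

lemma exec_for:
  fixes I :: "nat \<Rightarrow> nat \<Rightarrow> nat"
  assumes "s r = k" "s = (I 0)(r := k)" "t = (I k)(r := 0)"
    and "\<And>i. i < k \<Longrightarrow> exec B w c ((I i)(r := k - 1 - i)) [] ((I (Suc i))(r := k - 1 - i))"
  shows "exec B w (While r (Dec r ;; c)) s [] t"
  using exec_for_invariant[where I = I, OF assms(4)] unfolding assms(2,3) .

definition zero :: "nat \<Rightarrow> ('x, 'y) com" where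
  "zero r = While r (Dec r ;; Skip)"

lemma exec_zero: "t = s(r := 0) \<Longrightarrow> exec B w (zero r) s [] t"
  unfolding zero_def by (rule exec_for[where I = "\<lambda>i. s"]) (auto intro: exec.Skip)

lemma wf_zero [simp]: "wf_com X Y K (zero r) \<longleftrightarrow> r < K"
  by (simp add: zero_def)

primrec zeros :: "nat \<Rightarrow> nat \<Rightarrow> ('x, 'y) com" where
  "zeros a 0 = Skip"
| "zeros a (Suc k) = zeros a k ;; zero (a + k)"

lemma exec_zeros:
  fixes s :: "nat \<Rightarrow> nat"
  shows "t = (\<lambda>i. if a \<le> i \<and> i < a + k then 0 else s i) \<Longrightarrow> exec B w (zeros a k) s [] t"
proof (induction k arbitrary: t)
  case (Suc k)
  have "t = (\<lambda>i. if a \<le> i \<and> i < a + k then 0 else s i)(a + k := 0)"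
    by (auto simp: Suc.prems fun_eq_iff)
  then show ?case
    unfolding zeros.simps by (rule exec_Seq[OF Suc.IH[OF refl] exec_zero]) simp
next
  case 0
  then have "t = s" by (simp add: fun_eq_iff)
  then show ?case by (simp add: exec.Skip)
qed

lemma wf_zeros [simp]: "a + k \<le> K \<Longrightarrow> wf_com X Y K (zeros a k)"
  by (induction k) auto

definition copy :: "nat \<Rightarrow> nat \<Rightarrow> nat \<Rightarrow> ('x, 'y) com" where
  "copy r a tmp = While r (Dec r ;; Inc a ;; Inc tmp) ;; While tmp (Dec tmp ;; Inc r)"

lemma exec_copy:
  assumes "r \<noteq> a" "r \<noteq> tmp" "a \<noteq> tmp" "s tmp = 0" "s a = 0" "s r < B"
    and "t = s(a := s r)"
  shows "exec B w (copy r a tmp) s [] t"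
  unfolding copy_def
proof (rule exec_Seq)
  show "exec B w (While r (Dec r ;; Inc a ;; Inc tmp)) s [] (s(a := s r, tmp := s r, r := 0))"
    using assms
    by (intro exec_for[where I = "\<lambda>i. s(a := i, tmp := i)"])
       (auto simp: fun_eq_iff intro!: exec_Inc_Seq exec_Inc)
  show "exec B w (While tmp (Dec tmp ;; Inc r)) (s(a := s r, tmp := s r, r := 0)) [] t"
    using assms
    by (intro exec_for[where I = "\<lambda>i. s(a := s r, r := i)"])
       (auto simp: fun_eq_iff intro!: exec_Inc)
qed simp

lemma wf_copy [simp]: "wf_com X Y K (copy r a tmp) \<longleftrightarrow> r < K \<and> a < K \<and> tmp < K"
  by (auto simp: copy_def)

text \<open>
  Programs can only count up and down, so that multiplication and division by a constant
  have to be programmed. They give \<open>push\<close> and \<open>pop\<close>, which treat a register as a stack of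
  base-\<open>b\<close> digits.
\<close>

definition add_mult :: "nat \<Rightarrow> nat \<Rightarrow> nat \<Rightarrow> ('x, 'y) com" where
  "add_mult r a b = While r (Dec r ;; incs a b)"

lemma exec_add_mult:
  assumes "r \<noteq> a" "s a + b * s r < B" "t = s(r := 0, a := s a + b * s r)"
  shows "exec B w (add_mult r a b) s [] t"
  unfolding add_mult_def
proof (rule exec_for[where I = "\<lambda>i. s(a := s a + b * i)"])
  fix i assume "i < s r"
  then have "b * Suc i \<le> b * s r" by (intro mult_le_mono) auto
  then show "exec B w (incs a b) ((s(a := s a + b * i))(r := s r - 1 - i)) []
      ((s(a := s a + b * Suc i))(r := s r - 1 - i))"
    using assms by (intro exec_incs) (auto simp: fun_eq_iff)
qed (use assms in \<open>auto simp: fun_eq_iff\<close>)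

lemma wf_add_mult [simp]: "r < K \<Longrightarrow> a < K \<Longrightarrow> wf_com X Y K (add_mult r a b)"
  by (auto simp: add_mult_def)

definition push :: "nat \<Rightarrow> nat \<Rightarrow> nat \<Rightarrow> nat \<Rightarrow> ('x, 'y) com" where
  "push r tmp b d = add_mult r tmp b ;; add_mult tmp r 1 ;; incs r d"

lemma exec_push:
  assumes "r \<noteq> tmp" "s tmp = 0" "d + b * s r < B" "t = s(r := d + b * s r)"
  shows "exec B w (push r tmp b d) s [] t"
  unfolding push_def using assms
  by (intro exec_Seq[OF exec_add_mult[OF _ _ refl] exec_Seq[OF exec_add_mult[OF _ _ refl] exec_incs]])
     (auto simp: fun_eq_iff)

lemma wf_push [simp]: "r < K \<Longrightarrow> tmp < K \<Longrightarrow> wf_com X Y K (push r tmp b d)"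
  by (auto simp: push_def)

text \<open>
  One round of division by \<open>b\<close>: subtract \<open>b\<close> from \<open>r\<close> and count this in \<open>quo\<close>; if \<open>r\<close> runs out
  with \<open>j + 1\<close> decrements to go, the \<open>b - (j + 1)\<close> decrements already made are the remainder.
\<close>

primrec pop_round :: "nat \<Rightarrow> nat \<Rightarrow> nat \<Rightarrow> nat \<Rightarrow> nat \<Rightarrow> ('x, 'y) com" where
  "pop_round r quo m b 0 = Inc quo"
| "pop_round r quo m b (Suc j) = Cond r (Dec r ;; pop_round r quo m b j) (incs m (b - Suc j))"

lemma exec_pop_round:
  fixes w :: "'x list"
  assumes "r \<noteq> quo" "r \<noteq> m" "quo \<noteq> m" "j \<le> b" "Suc (s quo) < B" "s m + b < B"
    and "t = (if j \<le> s r then s(r := s r - j, quo := Suc (s quo))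
              else s(r := 0, m := s m + (b - j + s r)))"
  shows "exec B w (pop_round r quo m b j :: ('x, 'y) com) s [] t"
  using assms
proof (induction j arbitrary: s)
  case 0
  then show ?case by (auto intro!: exec_Inc simp: fun_eq_iff)
next
  case (Suc j)
  show ?case
  proof (cases "s r > 0")
    case True
    then obtain k where k: "s r = Suc k" by (cases "s r") auto
    let ?s = "s(r := k)"
    have "exec B w (pop_round r quo m b j :: ('x, 'y) com) ?s [] t"
    proof (rule Suc.IH)
      show "t = (if j \<le> ?s r then ?s(r := ?s r - j, quo := Suc (?s quo))
              else ?s(r := 0, m := ?s m + (b - j + ?s r)))"
        unfolding Suc.prems(7) using Suc.prems(1-4) k by (auto simp: fun_eq_iff)
    qed (use Suc.prems(1-6) in auto)
    then show ?thesis
      using k True by (auto intro!: exec.CondT exec_Dec_Seq[where k = k])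
  next
    case False
    then show ?thesis
      using Suc.prems by (auto intro!: exec.CondF exec_incs simp: fun_eq_iff)
  qed
qed

lemma wf_pop_round [simp]:
  "r < K \<Longrightarrow> quo < K \<Longrightarrow> m < K \<Longrightarrow> wf_com X Y K (pop_round r quo m b j)"
  by (induction j) auto

definition pop :: "nat \<Rightarrow> nat \<Rightarrow> nat \<Rightarrow> nat \<Rightarrow> ('x, 'y) com" where
  "pop r quo m b = While r (pop_round r quo m b b) ;; add_mult quo r 1"

lemma exec_pop_loop:
  fixes w :: "'x list" and r quo m b :: nat
  defines "c \<equiv> (While r (pop_round r quo m b b) :: ('x, 'y) com)"
  assumes "r \<noteq> quo" "r \<noteq> m" "quo \<noteq> m" "0 < b" "s m = 0" "s quo + s r < B" "b < B" "0 < B"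
  shows "exec B w c s []
    (s(r := 0, quo := s quo + s r div b, m := s r mod b))"
  using assms
proof (induction "s r" arbitrary: s rule: less_induct)
  case less
  consider "s r = 0" | "0 < s r" "s r < b" | "0 < s r" "b \<le> s r" by linarith
  then show ?case
  proof cases
    case 1
    then have "s(r := 0, quo := s quo + s r div b, m := s r mod b) = s"
      using less.prems by (auto simp: fun_eq_iff)
    then show ?thesis using 1 by (auto intro: exec.WhileF simp: c_def)
  next
    case 2
    have "exec B w (pop_round r quo m b b :: ('x, 'y) com) s [] (s(r := 0, m := s r))"
      using 2 less.prems by (intro exec_pop_round) (auto simp: fun_eq_iff)
    then have "exec B w c s ([] @ []) (s(r := 0, m := s r))"
      unfolding c_def using 2(1) less.prems by (rule_tac exec.WhileT) (assumption | rule exec.WhileF | simp)+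
    moreover have "s(r := 0, quo := s quo + s r div b, m := s r mod b) = s(r := 0, m := s r)"
      using 2 less.prems by (auto simp: fun_eq_iff)
    ultimately show ?thesis by simp
  next
    case 3
    let ?s = "s(r := s r - b, quo := Suc (s quo))"
    have "exec B w (pop_round r quo m b b :: ('x, 'y) com) s [] ?s"
      using 3 less.prems by (intro exec_pop_round) (auto simp: fun_eq_iff)
    moreover have "exec B w c ?s []
        (?s(r := 0, quo := ?s quo + ?s r div b, m := ?s r mod b))"
      using 3 less.prems by (intro less.hyps) auto
    ultimately have "exec B w c s ([] @ [])
        (?s(r := 0, quo := ?s quo + ?s r div b, m := ?s r mod b))"
      unfolding c_def using 3(1) by (intro exec.WhileT)
    moreover have "?s(r := 0, quo := ?s quo + ?s r div b, m := ?s r mod b) =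
        s(r := 0, quo := s quo + s r div b, m := s r mod b)"
      using 3 less.prems by (auto simp: fun_eq_iff le_div_geq le_mod_geq)
    ultimately show ?thesis by simp
  qed
qed

lemma exec_pop:
  assumes "r \<noteq> quo" "r \<noteq> m" "quo \<noteq> m" "0 < b" "s m = 0" "s quo = 0" "s r < B" "b < B"
    and "t = s(r := s r div b, m := s r mod b)"
  shows "exec B w (pop r quo m b) s [] t"
proof -
  have "s r div b < B" using assms(7) by (meson div_le_dividend order.strict_trans1)
  then show ?thesis
    unfolding pop_def using assms
    by (intro exec_Seq[OF exec_pop_loop exec_add_mult]) (auto simp: fun_eq_iff)
qed

lemma wf_pop [simp]: "r < K \<Longrightarrow> quo < K \<Longrightarrow> m < K \<Longrightarrow> wf_com X Y K (pop r quo m b)"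
  by (simp add: pop_def)

text \<open>
  The cascade of tests counts \<open>r\<close> down, so that the selected branch starts with \<open>r = 0\<close>.
\<close>

primrec switch :: "nat \<Rightarrow> ('x, 'y) com list \<Rightarrow> ('x, 'y) com" where
  "switch r [] = Skip"
| "switch r (c # cs) = Cond r (Dec r ;; switch r cs) c"

lemma exec_switch:
  fixes s :: "nat \<Rightarrow> nat"
  shows "s r < length cs \<Longrightarrow> exec B w (cs ! s r) (s(r := 0)) u t \<Longrightarrow> exec B w (switch r cs) s u t"
proof (induction cs arbitrary: s)
  case (Cons c cs)
  show ?case
  proof (cases "s r")
    case 0
    then have "s(r := 0) = s" by (auto simp: fun_eq_iff)
    with Cons.prems 0 show ?thesis by (auto intro: exec.CondF)
  next
    case (Suc j)
    have "exec B w ((c # cs) ! s r) (s(r := 0)) u t" by (rule Cons.prems)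
    then have "exec B w (switch r cs) (s(r := j)) u t"
    proof (intro Cons.IH)
      show "(s(r := j)) r < length cs"
        using Cons.prems(1) Suc by simp
      assume "exec B w ((c # cs) ! s r) (s(r := 0)) u t"
      then show "exec B w (cs ! (s(r := j)) r) ((s(r := j))(r := 0)) u t"
        using Suc by simp
    qed
    then show ?thesis
      unfolding switch.simps
      by (intro exec.CondT exec_Dec_Seq[where k = j]) (simp_all add: Suc)
  qed
qed simp

lemma wf_switch [simp]:
  "r < K \<Longrightarrow> wf_com X Y K (switch r cs) \<longleftrightarrow> (\<forall>c \<in> set cs. wf_com X Y K c)"
  by (induction cs) auto

section \<open>Composition of counter programs\<close>

text \<open>
  The output of the inner program may be too long to be stored. Whenever the outer program reads
  position \<open>j\<close> of it, the inner program is run from scratch, and all but its \<open>j\<close>-th output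
  letter are discarded. The registers of the outer program come first, followed by one register
  \<open>res\<close> for the letter found, and by those of the inner program.
\<close>

definition join_stores :: "nat \<Rightarrow> (nat \<Rightarrow> nat) \<Rightarrow> (nat \<Rightarrow> nat) \<Rightarrow> nat \<Rightarrow> nat" where
  "join_stores off s s' = (\<lambda>i. if i < off then s i else s' (i - off))"

lemma join_stores_low [simp]: "i < off \<Longrightarrow> join_stores off s s' i = s i"
  by (simp add: join_stores_def)

lemma join_stores_high [simp]: "join_stores off s s' (off + r) = s' r"
  by (simp add: join_stores_def)

lemma join_stores_upd_low: "i < off \<Longrightarrow> (join_stores off s s')(i := v) = join_stores off (s(i := v)) s'"
  by (auto simp: join_stores_def fun_eq_iff)

lemma join_stores_upd_high: "(join_stores off s s')(off + r := v) = join_stores off s (s'(r := v))"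
  by (auto simp: join_stores_def fun_eq_iff)

text \<open>
  The inner program as a part of the composite: its registers are out of the way of those of the
  outer program, and its output is diverted.
\<close>

primrec redirect :: "nat \<Rightarrow> ('y \<Rightarrow> ('x, 'z) com) \<Rightarrow> ('x, 'y) com \<Rightarrow> ('x, 'z) com" where
  "redirect off P Skip = Skip"
| "redirect off P (Inc r) = Inc (off + r)"
| "redirect off P (Dec r) = Dec (off + r)"
| "redirect off P (Out y) = P y"
| "redirect off P (c1 ;; c2) = redirect off P c1 ;; redirect off P c2"
| "redirect off P (Cond r c1 c2) = Cond (off + r) (redirect off P c1) (redirect off P c2)"
| "redirect off P (While r c) = While (off + r) (redirect off P c)"
| "redirect off P (Read r F) = Read (off + r) (\<lambda>a. redirect off P (F a))"

text \<open>
  If each \<open>P y\<close> acts on the low registers as \<open>T y\<close>, then the output word acts on them as the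
  composition of its letters, whatever the redirected program does with its own registers.
\<close>

lemma exec_redirect:
  assumes "exec B w c s' u t'"
    and "\<And>y s s'. y \<in> set u \<Longrightarrow> exec B w (P y) (join_stores off s s') [] (join_stores off (T y s) s')"
  shows "exec B w (redirect off P c) (join_stores off s s') [] (join_stores off (fold T u s) t')"
  using assms
proof (induction arbitrary: s rule: exec.induct)
  case (Skip s')
  then show ?case by (simp add: exec.Skip)
next
  case (Inc s' r)
  then show ?case by (auto intro!: exec_Inc simp: join_stores_def fun_eq_iff)
next
  case (Dec s' r k)
  then show ?case by (auto intro!: exec_Dec simp: join_stores_def fun_eq_iff)
next
  case (Out y s')
  then show ?case by simp
next
  case (Seq c1 s' u t' c2 v t'')
  have "exec B w (redirect off P c1 ;; redirect off P c2) (join_stores off s s') ([] @ [])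
      (join_stores off (fold T v (fold T u s)) t'')"
    by (rule exec.Seq) (rule Seq.IH, rule Seq.prems, simp)+
  then show ?case by simp
next
  case (CondT s' r c1 u t' c2)
  then show ?case by (auto intro: exec.CondT)
next
  case (CondF s' r c2 u t' c1)
  then show ?case by (auto intro: exec.CondF)
next
  case (WhileF s' r c)
  then show ?case by (auto intro: exec.WhileF)
next
  case (WhileT s' r c u t' v t'')
  have "exec B w (redirect off P c) (join_stores off s s') [] (join_stores off (fold T u s) t')"
    by (rule WhileT.IH, rule WhileT.prems) simp
  moreover have "exec B w (redirect off P (While r c)) (join_stores off (fold T u s) t') []
      (join_stores off (fold T v (fold T u s)) t'')"
    by (rule WhileT.IH, rule WhileT.prems) simp
  ultimately have "exec B w (While (off + r) (redirect off P c)) (join_stores off s s') ([] @ [])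
      (join_stores off (fold T v (fold T u s)) t'')"
    using WhileT.hyps(1) by (intro exec.WhileT) auto
  then show ?case by simp
next
  case (Read F s' r u t')
  have "exec B w (redirect off P (F (scanned_input w (s' r)))) (join_stores off s (s'(r := 0))) []
      (join_stores off (fold T u s) t')"
    by (rule Read.IH, rule Read.prems)
  then show ?case by (auto intro!: exec.Read simp: join_stores_upd_high)
qed

lemma wf_redirect:
  "wf_com X Y K c \<Longrightarrow> (\<And>y. y \<in> Y \<Longrightarrow> wf_com X Z K' (P y)) \<Longrightarrow> off + K \<le> K' \<Longrightarrow>
    wf_com X Z K' (redirect off P c)"
  by (induction c) auto

definition letter_code :: "'y list \<Rightarrow> 'y \<Rightarrow> nat" where
  "letter_code ys y = Suc (SOME i. i < length ys \<and> ys ! i = y)"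

lemma letter_code: "y \<in> set ys \<Longrightarrow> \<exists>i < length ys. letter_code ys y = Suc i \<and> ys ! i = y"
  using someI_ex[of "\<lambda>i. i < length ys \<and> ys ! i = y"]
  by (auto simp: letter_code_def in_set_conv_nth)

text \<open>
  What is done in place of the output of a letter with code \<open>k\<close>: \<open>j\<close> counts down the letters still
  to be skipped, and \<open>k\<close> is recorded when \<open>j\<close> goes from \<open>1\<close> to \<open>0\<close>. Once \<open>j\<close> is \<open>0\<close>, further letters
  change nothing.
\<close>

definition tick :: "nat \<Rightarrow> nat \<Rightarrow> nat \<Rightarrow> ('x, 'z) com" where
  "tick j res k = Cond j (Dec j ;; Cond j Skip (zero res ;; incs res k)) Skip"

definition ticked :: "nat \<Rightarrow> nat \<Rightarrow> nat \<Rightarrow> (nat \<Rightarrow> nat) \<Rightarrow> nat \<Rightarrow> nat" where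
  "ticked j res k s =
     (if s j = 0 then s else if s j = 1 then s(j := 0, res := k) else s(j := s j - 1))"

lemma exec_tick:
  fixes s :: "nat \<Rightarrow> nat"
  assumes "j \<noteq> res" "k < B"
  shows "exec B w (tick j res k) s [] (ticked j res k s)"
proof -
  consider "s j = 0" | "s j = 1" | k' where "s j = Suc (Suc k')"
    by (metis One_nat_def not0_implies_Suc)
  then show ?thesis
  proof cases
    case 1
    then show ?thesis by (auto simp: tick_def ticked_def intro: exec.CondF exec.Skip)
  next
    case 2
    let ?s = "s(j := 0)"
    have "exec B w (zero res ;; incs res k) ?s [] (s(j := 0, res := k))"
      by (rule exec_Seq[OF exec_zero[OF refl] exec_incs]) (use assms in auto)
    then have "exec B w (Cond j Skip (zero res ;; incs res k)) ?s [] (s(j := 0, res := k))"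
      using assms by (intro exec.CondF) auto
    then show ?thesis
      unfolding tick_def ticked_def using 2
      by (auto simp: fun_upd_twist intro: exec.CondT[OF _ exec_Dec_Seq[where k = 0]])
  next
    case 3
    then show ?thesis
      by (auto simp: tick_def ticked_def
          intro!: exec.CondT exec_Dec_Seq[where k = "Suc k'"] exec.Skip)
  qed
qed

lemma fold_ticked:
  assumes "j \<noteq> res"
  shows "fold (\<lambda>y. ticked j res (f y)) u s =
    (if s j = 0 then s else if s j \<le> length u then s(j := 0, res := f (u ! (s j - 1)))
     else s(j := s j - length u))"
proof (induction u arbitrary: s)
  case (Cons y u)
  show ?case
    unfolding fold_Cons comp_def Cons.IH using assms
    by (auto simp: ticked_def fun_eq_iff nth_Cons' Suc_le_eq)
qed (auto simp: fun_eq_iff)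

text \<open>
  Branches on the symbol at the position held by \<open>j\<close> in the output of \<open>A\<close>. Letters have positive codes,
  so \<open>res = 0\<close> after the run means that the output has fewer than \<open>j\<close> letters. Then \<open>A\<close>'s registers and
  \<open>j\<close> are cleared, so that the outer program sees the same store as after its own reading.
\<close>

definition fetch ::
    "('x, 'y) com \<Rightarrow> nat \<Rightarrow> nat \<Rightarrow> 'y list \<Rightarrow> nat \<Rightarrow> ('y input_symbol \<Rightarrow> ('x, 'z) com) \<Rightarrow> ('x, 'z) com"
  where
  "fetch A K res ys j F =
     Cond j
       (redirect (Suc res) (\<lambda>y. tick j res (letter_code ys y)) A ;; zeros (Suc res) K ;; zero j ;;
        switch res (F RightEnd # map (\<lambda>y. F (Letter y)) ys))
       (F LeftEnd)"

lemma exec_fetch: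
  fixes A :: "('x, 'y) com" and F :: "'y input_symbol \<Rightarrow> ('x, 'z) com" and s :: "nat \<Rightarrow> nat"
  assumes A: "exec B w A (\<lambda>_. 0) v t'" "wf_com X Y K A" "w \<in> lists X"
    and v: "set v \<subseteq> set ys" and B: "length ys < B"
    and j: "j < res" and res: "s res = 0"
    and F: "exec B w (F (scanned_input v (s j))) (join_stores (Suc res) (s(j := 0)) (\<lambda>_. 0)) u t"
  shows "exec B w (fetch A K res ys j F) (join_stores (Suc res) s (\<lambda>_. 0)) u t"
proof (cases "s j = 0")
  case True
  then have "s(j := 0) = s" by auto
  with True F j show ?thesis
    by (auto simp: fetch_def scanned_input_def intro!: exec.CondF)
next
  case False
  let ?T = "\<lambda>y. ticked j res (letter_code ys y)"
  let ?P = "\<lambda>y. tick j res (letter_code ys y) :: ('x, 'z) com"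
  let ?s = "fold ?T v s"
  have frame: "t' r = 0" if "K \<le> r" for r
    using exec_frame[OF A(1,2,3) that] .
  have "exec B w (?P y) (join_stores (Suc res) s s') [] (join_stores (Suc res) (?T y s) s')" if "y \<in> set v" for y s s'
  proof -
    have "letter_code ys y < B" using letter_code[of y ys] that v B by fastforce
    then have "exec B w (?P y) (join_stores (Suc res) s s') []
        (ticked j res (letter_code ys y) (join_stores (Suc res) s s'))"
      using j by (intro exec_tick) auto
    moreover have "ticked j res (letter_code ys y) (join_stores (Suc res) s s') = join_stores (Suc res) (?T y s) s'"
      using j by (auto simp: ticked_def join_stores_upd_low)
    ultimately show ?thesis by simp
  qed
  then have 1: "exec B w (redirect (Suc res) ?P A) (join_stores (Suc res) s (\<lambda>_. 0)) [] (join_stores (Suc res) ?s t')"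
    using A(1) by (intro exec_redirect) auto
  have 2: "exec B w (zeros (Suc res) K :: ('x, 'z) com) (join_stores (Suc res) ?s t') []
      (join_stores (Suc res) ?s (\<lambda>_. 0))"
    by (rule exec_zeros) (auto simp: join_stores_def fun_eq_iff frame)
  have 3: "exec B w (zero j :: ('x, 'z) com) (join_stores (Suc res) ?s (\<lambda>_. 0)) []
      (join_stores (Suc res) (?s(j := 0)) (\<lambda>_. 0))"
    by (rule exec_zero) (use j in \<open>simp add: join_stores_upd_low\<close>)
  let ?cs = "F RightEnd # map (\<lambda>y. F (Letter y)) ys"
  have s_res: "?s res = (if s j \<le> length v then letter_code ys (v ! (s j - 1)) else 0)"
    using False j res by (subst fold_ticked) auto
  have s_eq: "?s(j := 0, res := 0) = s(j := 0)"
    using False j res by (subst fold_ticked) (auto simp: fun_eq_iff)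
  have "?s res < length ?cs \<and> ?cs ! ?s res = F (scanned_input v (s j))"
  proof (cases "s j \<le> length v")
    case True
    then have "v ! (s j - 1) \<in> set ys" using v False by (auto intro!: nth_mem)
    from letter_code[OF this] obtain i where
      "i < length ys" "letter_code ys (v ! (s j - 1)) = Suc i" "ys ! i = v ! (s j - 1)" by auto
    then show ?thesis using s_res True False by (auto simp: scanned_input_def)
  next
    case 2: False
    then show ?thesis using s_res False by (auto simp: scanned_input_def)
  qed
  then have 4: "exec B w (switch res ?cs) (join_stores (Suc res) (?s(j := 0)) (\<lambda>_. 0)) u t"
    using F j by (intro exec_switch) (auto simp: join_stores_upd_low s_eq)
  have "exec B w (redirect (Suc res) ?P A ;; zeros (Suc res) K ;; zero j ;; switch res ?cs)
      (join_stores (Suc res) s (\<lambda>_. 0)) u t"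
    by (rule exec_Seq[OF 1 exec_Seq[OF 2 exec_Seq[OF 3 4]]]) simp_all
  then show ?thesis
    unfolding fetch_def using False j by (intro exec.CondT) auto
qed

lemma wf_fetch:
  assumes "wf_com X Y K A" "j < res" "Suc res + K \<le> K'" "set ys \<subseteq> Y"
    and "\<And>a. a \<in> input_symbols Y \<Longrightarrow> wf_com X Z K' (F a)"
  shows "wf_com X Z K' (fetch A K res ys j F)"
  using assms
  by (auto simp: fetch_def tick_def input_symbols_def intro!: wf_redirect[where Y = Y])

primrec compose ::
    "('x, 'y) com \<Rightarrow> nat \<Rightarrow> nat \<Rightarrow> 'y list \<Rightarrow> ('y, 'z) com \<Rightarrow> ('x, 'z) com" where
  "compose A K res ys Skip = Skip"
| "compose A K res ys (Inc r) = Inc r"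
| "compose A K res ys (Dec r) = Dec r"
| "compose A K res ys (Out z) = Out z"
| "compose A K res ys (c1 ;; c2) = compose A K res ys c1 ;; compose A K res ys c2"
| "compose A K res ys (Cond r c1 c2) = Cond r (compose A K res ys c1) (compose A K res ys c2)"
| "compose A K res ys (While r c) = While r (compose A K res ys c)"
| "compose A K res ys (Read r F) = fetch A K res ys r (\<lambda>a. compose A K res ys (F a))"

lemma wf_compose:
  assumes "wf_com X Y K A" "Suc res + K \<le> K'" "set ys = Y"
  shows "wf_com Y Z res c \<Longrightarrow> wf_com X Z K' (compose A K res ys c)"
  using assms by (induction c) (auto intro!: wf_fetch[where Y = Y])

lemma exec_compose:
  fixes A :: "('x, 'y) com" and s :: "nat \<Rightarrow> nat"
  assumes A: "exec B w A (\<lambda>_. 0) v t'" "wf_com X Y K A" "w \<in> lists X"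
    and v: "v \<in> lists Y" and ys: "set ys = Y" "length ys < B"
    and c: "exec B v c s u t" "wf_com Y Z res c" "\<And>r. res \<le> r \<Longrightarrow> s r = 0"
  shows "exec B w (compose A K res ys c) (join_stores (Suc res) s (\<lambda>_. 0)) u (join_stores (Suc res) t (\<lambda>_. 0))"
  using c
proof (induction rule: exec.induct)
  case (Skip s)
  then show ?case by (simp add: exec.Skip)
next
  case (Inc s r)
  then show ?case by (auto intro!: exec_Inc simp: join_stores_def fun_eq_iff)
next
  case (Dec s r k)
  then show ?case by (auto intro!: exec_Dec simp: join_stores_def fun_eq_iff)
next
  case (Out y s)
  then show ?case by (simp add: exec.Out)
next
  case (Seq c1 s u s' c2 v' t)
  have "s' r = 0" if "res \<le> r" for r
    using exec_frame[OF Seq.hyps(1) _ v that] Seq.prems that by auto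
  then show ?case using Seq by (auto intro!: exec.Seq)
next
  case (CondT s r c1 u t c2)
  then show ?case by (auto intro!: exec.CondT)
next
  case (CondF s r c2 u t c1)
  then show ?case by (auto intro!: exec.CondF)
next
  case (WhileF s r c)
  then show ?case by (auto intro!: exec.WhileF)
next
  case (WhileT s r c u s' v' t)
  have "s' r = 0" if "res \<le> r" for r
    using exec_frame[OF WhileT.hyps(2) _ v that] WhileT.prems that by auto
  then show ?case using WhileT by (auto intro!: exec.WhileT)
next
  case (Read F s r u t)
  have r: "r < res" using Read.prems by simp
  have "exec B w (compose A K res ys (F (scanned_input v (s r)))) (join_stores (Suc res) (s(r := 0)) (\<lambda>_. 0)) u
      (join_stores (Suc res) t (\<lambda>_. 0))"
    using Read.prems scanned_input_in_input_symbols[OF v] by (intro Read.IH) auto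
  then show ?case
    unfolding compose.simps using A v ys r Read.prems(2)
    by (intro exec_fetch) auto
qed

text \<open>
  Here \<open>m\<close> is the length of an intermediate word. The bound for the program that is run on it is a power of
  \<open>m + 2\<close> and has to be expressed by the length \<open>n\<close> of the original input.
\<close>

lemma power_bounds:
  fixes n d e :: nat
  assumes "m \<le> (n + 2) ^ d"
  shows "(m + 2) ^ e \<le> (n + 2) ^ ((d + 2) * e)"
proof -
  have "1 \<le> (n + 2) ^ d" by (rule one_le_power) simp
  then have "m + 2 \<le> (n + 2) ^ d + 2 * (n + 2) ^ d" using assms by linarith
  also have "\<dots> \<le> (n + 2) ^ d * (n + 2) ^ 2"
    by (simp add: power2_eq_square algebra_simps)
  also have "\<dots> = (n + 2) ^ (d + 2)" by (simp only: power_add)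
  finally have "(m + 2) ^ e \<le> ((n + 2) ^ (d + 2)) ^ e" by (intro power_mono) simp_all
  then show ?thesis by (simp only: power_mult)
qed

theorem while_computable_comp:
  assumes f: "while_computable X Y S f" and g: "while_computable Y Z S' g"
    and "\<And>w. w \<in> S \<Longrightarrow> f w \<in> S'"
  shows "while_computable X Z S (\<lambda>w. g (f w))"
proof -
  from f obtain A K d where A: "wf_com X Y K A"
    and A_len: "\<And>w. w \<in> S \<Longrightarrow> length (f w) \<le> (length w + 2) ^ d"
    and A_exec: "\<And>w. w \<in> S \<Longrightarrow> \<exists>t. exec ((length w + 2) ^ d) w A (\<lambda>_. 0) (f w) t"
    unfolding while_computable_def by blast
  from g obtain c res e where c: "wf_com Y Z res c"
    and c_len: "\<And>w. w \<in> S' \<Longrightarrow> length (g w) \<le> (length w + 2) ^ e"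
    and c_exec: "\<And>w. w \<in> S' \<Longrightarrow> \<exists>t. exec ((length w + 2) ^ e) w c (\<lambda>_. 0) (g w) t"
    unfolding while_computable_def by blast
  have SX: "S \<subseteq> lists X" and fY: "\<And>w. w \<in> S \<Longrightarrow> f w \<in> lists Y"
    using f by (auto simp: while_computable_def)
  have "finite Y" using f by (simp add: while_computable_def)
  then obtain ys where ys: "set ys = Y" using finite_list by auto
  \<comment> \<open>covers the values of the inner program, those of the outer program on its longer input, and the
    letter codes\<close>
  define D where "D = d + (d + 2) * e + length ys"
  have "length (g (f w)) \<le> (length w + 2) ^ D \<and>
      (\<exists>t. exec ((length w + 2) ^ D) w (compose A K res ys c) (\<lambda>_. 0) (g (f w)) t)"
    if w: "w \<in> S" for w
  proof -
    let ?v = "f w" and ?N = "length w + 2"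
    have grow: "?N ^ k \<le> ?N ^ D" if "k \<le> D" for k
      using that by (intro power_increasing) auto
    have le1: "?N ^ d \<le> ?N ^ D" by (rule grow) (simp add: D_def)
    have le2: "(length ?v + 2) ^ e \<le> ?N ^ D"
      by (rule order_trans[OF power_bounds[OF A_len[OF w]] grow]) (simp add: D_def)
    have "length ys < 2 ^ length ys" by simp
    also have "\<dots> \<le> ?N ^ length ys" by (intro power_mono) auto
    also have "\<dots> \<le> ?N ^ D" by (rule grow) (simp add: D_def)
    finally have le3: "length ys < ?N ^ D" .
    from A_exec[OF w] obtain t1 where t1: "exec (?N ^ d) w A (\<lambda>_. 0) ?v t1" ..
    from c_exec[OF assms(3)[OF w]] obtain t2
      where t2: "exec ((length ?v + 2) ^ e) ?v c (\<lambda>_. 0) (g ?v) t2" ..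
    have "exec (?N ^ D) w (compose A K res ys c) (join_stores (Suc res) (\<lambda>_. 0) (\<lambda>_. 0)) (g ?v)
        (join_stores (Suc res) t2 (\<lambda>_. 0))"
      using w SX fY A ys le3 c
      by (intro exec_compose[OF exec_mono[OF t1 le1] A _ _ ys _ exec_mono[OF t2 le2]]) auto
    moreover have "join_stores (Suc res) (\<lambda>_. 0) (\<lambda>_. 0) = (\<lambda>_. 0)" by (auto simp: join_stores_def)
    ultimately show ?thesis
      using c_len[OF assms(3)[OF w]] le2 by auto
  qed
  moreover have "wf_com X Z (Suc res + K) (compose A K res ys c)"
    by (rule wf_compose[OF A _ ys c]) simp
  ultimately show ?thesis
    using f g assms(3) unfolding while_computable_def by blast
qed

section \<open>Homomorphisms, reversal and concatenation\<close>

text \<open>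
  A scan from left to right can apply a homomorphism to the input, and the scan back from right
  to left a homomorphism to its reversal. One program that does both covers these two cases.
  Register \<open>0\<close> is a flag that is set until the right end is reached, register \<open>1\<close> the position, and
  registers \<open>2\<close> and \<open>3\<close> serve to read without losing the position.
\<close>

definition scan_forward :: "('x \<Rightarrow> 'y list) \<Rightarrow> ('x, 'y) com" where
  "scan_forward f =
     While 0 (Inc 1 ;; copy 1 2 3 ;;
       Read 2 (\<lambda>a. case a of LeftEnd \<Rightarrow> Skip | Letter x \<Rightarrow> outs (f x) | RightEnd \<Rightarrow> Dec 0))"

definition scan_backward :: "('x \<Rightarrow> 'y list) \<Rightarrow> ('x, 'y) com" where
  "scan_backward g =
     While 1 (Dec 1 ;; copy 1 2 3 ;;
       Read 2 (\<lambda>a. case a of LeftEnd \<Rightarrow> Skip | Letter x \<Rightarrow> outs (g x) | RightEnd \<Rightarrow> Skip))"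

definition scan_store :: "nat \<Rightarrow> nat \<Rightarrow> nat \<Rightarrow> nat" where
  "scan_store flag i = (\<lambda>_. 0)(0 := flag, 1 := i)"

lemma scan_store_simps [simp]:
  "scan_store flag i 0 = flag" "scan_store flag i (Suc 0) = i"
  "(scan_store flag i)(0 := flag') = scan_store flag' i"
  "(scan_store flag i)(Suc 0 := j) = scan_store flag j"
  "scan_store 0 0 = (\<lambda>_. 0)"
  by (auto simp: scan_store_def fun_eq_iff)

lemma exec_read_at:
  fixes F :: "'x input_symbol \<Rightarrow> ('x, 'y) com"
  assumes "i < B" "exec B w (F (scanned_input w i)) (scan_store flag i) u t"
  shows "exec B w (copy 1 2 3 ;; Read 2 F) (scan_store flag i) u t"
proof -
  let ?s = "(scan_store flag i)(2 := i)"
  have "exec B w (copy 1 2 3 :: ('x, 'y) com) (scan_store flag i) [] ?s"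
    using assms(1) by (intro exec_copy) (auto simp: scan_store_def fun_eq_iff)
  moreover have "?s(2 := 0) = scan_store flag i" by (auto simp: scan_store_def fun_eq_iff)
  then have "exec B w (Read 2 F) ?s u t"
    using assms(2) by (intro exec.Read) simp
  ultimately show ?thesis by (rule exec_Seq) simp
qed

lemma exec_scan_forward:
  "i \<le> length w \<Longrightarrow> length w + 1 < B \<Longrightarrow>
   exec B w (scan_forward f) (scan_store 1 i) (concat (map f (drop i w))) (scan_store 0 (length w + 1))"
proof (induction "length w - i" arbitrary: i)
  case 0
  then have i: "i = length w" by simp
  let ?s = "scan_store 1 (length w + 1)" and ?t = "scan_store 0 (length w + 1)"
  let ?F = "\<lambda>a. case a of LeftEnd \<Rightarrow> Skip | Letter x \<Rightarrow> outs (f x) | RightEnd \<Rightarrow> Dec 0"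
  have "exec B w (copy 1 2 3 ;; Read 2 ?F) ?s [] ?t"
    using 0 by (intro exec_read_at) (auto simp: scanned_input_def intro!: exec_Dec)
  then have "exec B w (Inc 1 ;; copy 1 2 3 ;; Read 2 ?F) (scan_store 1 i) [] ?t"
    using 0 i by (intro exec_Inc_Seq) simp_all
  then have "exec B w (scan_forward f) (scan_store 1 i) ([] @ []) ?t"
    unfolding scan_forward_def by (rule exec.WhileT[rotated, OF _ exec.WhileF]) simp_all
  then show ?case by (simp add: i)
next
  case (Suc k)
  then have i: "i < length w" by simp
  let ?s = "scan_store 1 (Suc i)"
  let ?F = "\<lambda>a. case a of LeftEnd \<Rightarrow> Skip | Letter x \<Rightarrow> outs (f x) | RightEnd \<Rightarrow> Dec 0"
  have "exec B w (copy 1 2 3 ;; Read 2 ?F) ?s (f (w ! i)) ?s"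
    using Suc.prems i by (intro exec_read_at) (auto simp: scanned_input_def exec_outs)
  then have "exec B w (Inc 1 ;; copy 1 2 3 ;; Read 2 ?F) (scan_store 1 i) (f (w ! i)) ?s"
    using Suc.prems i by (intro exec_Inc_Seq) simp_all
  moreover have "exec B w (scan_forward f) ?s (concat (map f (drop (Suc i) w)))
      (scan_store 0 (length w + 1))"
    using Suc i by (intro Suc.hyps) auto
  ultimately have "exec B w (scan_forward f) (scan_store 1 i)
      (f (w ! i) @ concat (map f (drop (Suc i) w))) (scan_store 0 (length w + 1))"
    unfolding scan_forward_def by (intro exec.WhileT) auto
  then show ?case using i by (simp add: Cons_nth_drop_Suc[symmetric])
qed

lemma exec_scan_backward:
  "i \<le> length w + 1 \<Longrightarrow> length w + 1 < B \<Longrightarrow>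
   exec B w (scan_backward g) (scan_store 0 i) (concat (map g (rev (take (i - 1) w)))) (\<lambda>_. 0)"
proof (induction i)
  case 0
  show ?case by (auto simp: scan_backward_def intro!: exec.WhileF)
next
  case (Suc i)
  let ?F = "\<lambda>a. case a of LeftEnd \<Rightarrow> Skip | Letter x \<Rightarrow> outs (g x) | RightEnd \<Rightarrow> Skip"
  define u where "u = (if i = 0 then [] else g (w ! (i - 1)))"
  have "exec B w (copy 1 2 3 ;; Read 2 ?F) (scan_store 0 i) u (scan_store 0 i)"
    using Suc.prems
    by (intro exec_read_at) (auto simp: scanned_input_def u_def exec_outs exec.Skip)
  then have "exec B w (Dec 1 ;; copy 1 2 3 ;; Read 2 ?F) (scan_store 0 (Suc i)) u (scan_store 0 i)"
    by (intro exec_Dec_Seq[where k = i]) simp_all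
  moreover have "exec B w (scan_backward g) (scan_store 0 i) (concat (map g (rev (take (i - 1) w))))
      (\<lambda>_. 0)"
    using Suc by simp
  ultimately have "exec B w (scan_backward g) (scan_store 0 (Suc i))
      (u @ concat (map g (rev (take (i - 1) w)))) (\<lambda>_. 0)"
    unfolding scan_backward_def by (intro exec.WhileT) auto
  moreover have "u @ concat (map g (rev (take (i - 1) w))) = concat (map g (rev (take i w)))"
    using Suc.prems by (cases i) (auto simp: u_def take_Suc_conv_app_nth)
  ultimately show ?case by simp
qed

lemma length_concat_map_le:
  "(\<And>x. x \<in> set w \<Longrightarrow> length (f x) \<le> m) \<Longrightarrow> length (concat (map f w)) \<le> m * length w"
  by (induction w) (auto simp: add_mono)

lemma while_computable_scan:
  assumes "finite X" "finite Y"
    and "\<And>x. x \<in> X \<Longrightarrow> f x \<in> lists Y" "\<And>x. x \<in> X \<Longrightarrow> g x \<in> lists Y"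
  shows "while_computable X Y (lists X) (\<lambda>w. concat (map f w) @ concat (map g (rev w)))"
proof -
  let ?h = "\<lambda>w. concat (map f w) @ concat (map g (rev w))"
  let ?c = "Inc 0 ;; scan_forward f ;; scan_backward g"
  define m where "m = (\<Sum>x\<in>X. length (f x) + length (g x))"
  have m: "length (f x) + length (g x) \<le> m" if "x \<in> X" for x
    unfolding m_def using assms(1) that by (intro member_le_sum) auto
  have "length (?h w) \<le> (length w + 2) ^ (m + 2) \<and>
      (\<exists>t. exec ((length w + 2) ^ (m + 2)) w ?c (\<lambda>_. 0) (?h w) t)" if w: "w \<in> lists X" for w
  proof
    let ?N = "length w + 2"
    have "length (f x) \<le> m" "length (g x) \<le> m" if "x \<in> set w" for x
      using m[of x] w that by auto
    then have "length (concat (map f w)) \<le> m * length w"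
      "length (concat (map g (rev w))) \<le> m * length (rev w)"
      by (intro length_concat_map_le; simp)+
    then have "length (?h w) \<le> (2 * m) * length w" by simp
    also have "\<dots> \<le> 2 ^ (m + 1) * ?N"
      using less_exp[of m] by (intro mult_le_mono) auto
    also have "\<dots> \<le> ?N ^ (m + 1) * ?N" by (intro mult_le_mono1 power_mono) simp_all
    also have "\<dots> = ?N ^ (m + 2)" by (simp only: power_add power_one_right power2_eq_square mult.assoc)
    finally show "length (?h w) \<le> ?N ^ (m + 2)" .
    have "?N ^ 1 \<le> ?N ^ (m + 2)" by (intro power_increasing) auto
    then have B: "length w + 1 < ?N ^ (m + 2)" by simp
    have 1: "exec (?N ^ (m + 2)) w (Inc 0) (\<lambda>_. 0) [] (scan_store 1 0)"
      using B by (intro exec_Inc) (auto simp: scan_store_def fun_eq_iff)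
    have 2: "exec (?N ^ (m + 2)) w (scan_forward f) (scan_store 1 0) (concat (map f w))
        (scan_store 0 (length w + 1))"
      using exec_scan_forward[of 0 w, OF _ B] by simp
    have 3: "exec (?N ^ (m + 2)) w (scan_backward g) (scan_store 0 (length w + 1))
        (concat (map g (rev w))) (\<lambda>_. 0)"
      using exec_scan_backward[of "length w + 1" w, OF _ B] by simp
    show "\<exists>t. exec (?N ^ (m + 2)) w ?c (\<lambda>_. 0) (?h w) t"
      by (rule exI, rule exec_Seq[OF 1 exec_Seq[OF 2 3 refl]]) simp
  qed
  moreover have "wf_com X Y 4 ?c"
    using assms(3,4) by (auto simp: scan_forward_def scan_backward_def input_symbols_def)
  moreover have "?h \<in> lists X \<rightarrow> lists Y" using assms(3,4) by (auto simp: in_lists_conv_set) blast+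
  ultimately show ?thesis
    using assms(1,2) unfolding while_computable_def by blast
qed

text \<open>
  The empty homomorphism in one of the two directions leaves a scan in the other direction.
\<close>

lemma concat_map_Nil [simp]: "concat (map (\<lambda>_. []) w) = []"
  by simp

lemma while_computable_hom:
  assumes "finite X" "finite Y" "\<And>x. x \<in> X \<Longrightarrow> f x \<in> lists Y"
  shows "while_computable X Y (lists X) (\<lambda>w. concat (map f w))"
  using while_computable_scan[where f = f and g = "\<lambda>_. []"] assms by simp

lemma while_computable_reverse_hom:
  assumes "finite X" "finite Y" "\<And>x. x \<in> X \<Longrightarrow> g x \<in> lists Y"
  shows "while_computable X Y (lists X) (\<lambda>w. concat (map g (rev w)))"
  using while_computable_scan[where f = "\<lambda>_. []" and g = g] assms by simp

lemma while_computable_append: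
  assumes f: "while_computable X Y S f" and g: "while_computable X Y S g"
  shows "while_computable X Y S (\<lambda>w. f w @ g w)"
proof -
  from f obtain c K d where c: "wf_com X Y K c"
    and c_len: "\<And>w. w \<in> S \<Longrightarrow> length (f w) \<le> (length w + 2) ^ d"
    and c_exec: "\<And>w. w \<in> S \<Longrightarrow> \<exists>t. exec ((length w + 2) ^ d) w c (\<lambda>_. 0) (f w) t"
    unfolding while_computable_def by blast
  from g obtain c' K' d' where c': "wf_com X Y K' c'"
    and c'_len: "\<And>w. w \<in> S \<Longrightarrow> length (g w) \<le> (length w + 2) ^ d'"
    and c'_exec: "\<And>w. w \<in> S \<Longrightarrow> \<exists>t. exec ((length w + 2) ^ d') w c' (\<lambda>_. 0) (g w) t"
    unfolding while_computable_def by blast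
  have SX: "S \<subseteq> lists X" using f by (simp add: while_computable_def)
  let ?c = "c ;; zeros 0 K ;; c'"
  have "length (f w @ g w) \<le> (length w + 2) ^ (d + d' + 1) \<and>
      (\<exists>t. exec ((length w + 2) ^ (d + d' + 1)) w ?c (\<lambda>_. 0) (f w @ g w) t)" if w: "w \<in> S" for w
  proof
    let ?N = "length w + 2"
    have le: "?N ^ d \<le> ?N ^ (d + d')" "?N ^ d' \<le> ?N ^ (d + d')"
      by (intro power_increasing; simp)+
    then have "length (f w @ g w) \<le> 2 * ?N ^ (d + d')"
      using c_len[OF w] c'_len[OF w] unfolding length_append by linarith
    also have "\<dots> \<le> ?N * ?N ^ (d + d')" by (intro mult_le_mono1) simp
    finally show "length (f w @ g w) \<le> ?N ^ (d + d' + 1)" by simp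
    have le': "?N ^ d \<le> ?N ^ (d + d' + 1)" "?N ^ d' \<le> ?N ^ (d + d' + 1)"
      by (intro power_increasing; simp)+
    from c_exec[OF w] obtain t where t: "exec (?N ^ d) w c (\<lambda>_. 0) (f w) t" ..
    from c'_exec[OF w] obtain t' where t': "exec (?N ^ d') w c' (\<lambda>_. 0) (g w) t'" ..
    have frame: "t r = 0" if "K \<le> r" for r
      using exec_frame[OF t c _ that] w SX by auto
    have z: "exec (?N ^ (d + d' + 1)) w (zeros 0 K :: ('a, 'b) com) t [] (\<lambda>_. 0)"
      by (rule exec_zeros) (auto simp: fun_eq_iff frame)
    have "exec (?N ^ (d + d' + 1)) w ?c (\<lambda>_. 0) (f w @ g w) t'"
      by (rule exec_Seq[OF exec_mono[OF t le'(1)] exec_Seq[OF z exec_mono[OF t' le'(2)] refl]]) simp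
    then show "\<exists>t. exec (?N ^ (d + d' + 1)) w ?c (\<lambda>_. 0) (f w @ g w) t" by (intro exI)
  qed
  moreover have "wf_com X Y (K + K') ?c"
    using wf_com_mono[OF c, of "K + K'"] wf_com_mono[OF c', of "K + K'"] by simp
  moreover have "(\<lambda>w. f w @ g w) \<in> S \<rightarrow> lists Y"
    using f g unfolding while_computable_def Pi_iff append_in_lists_conv by blast
  ultimately show ?thesis
    using f unfolding while_computable_def by blast
qed

section \<open>The output of a logspace transducer has polynomial length\<close>

text \<open>
  A transducer that runs in logarithmic space passes through polynomially many configurations, up
  to the content of its output tape. As it is deterministic, a halting run repeats none of them, and
  this bounds the length of the output.
\<close>

definition halted :: "('q, 'g, 'x, 'y) transducer \<Rightarrow> 'x list \<Rightarrow> ('q, 'g, 'y) config \<Rightarrow> bool" where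
  "halted M w c \<longleftrightarrow> current_trans M w c = None"

lemma step_deterministic: "step M w c c1 \<Longrightarrow> step M w c c2 \<Longrightarrow> c1 = c2"
  by (auto simp: step_def)

lemma halted_no_step: "halted M w c \<Longrightarrow> \<not> step M w c c'"
  by (auto simp: step_def halted_def)

lemma reachable_init: "reachable M w (init_config M)"
  by (simp add: reachable_def)

lemma reachable_step: "reachable M w c \<Longrightarrow> step M w c c' \<Longrightarrow> reachable M w c'"
  unfolding reachable_def by (rule rtranclp.rtrancl_into_rtrancl)

lemma reachable_wf:
  assumes M: "wf_transducer X Y M" and w: "w \<in> lists X" and c: "reachable M w c"
  shows "state c \<in> states M \<and> (\<forall>i. work_tape c i \<in> work_alphabet M) \<and> input_pos c \<le> length w + 1"
  using c unfolding reachable_def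
proof (induction rule: rtranclp_induct)
  case base
  then show ?case using M by (auto simp: init_config_def wf_transducer_def)
next
  case (step c c')
  then obtain q g mi mw u where tr: "trans M (state c) (scanned_input w (input_pos c))
      (work_tape c (work_pos c)) = Some (q, g, mi, mw, u)"
    and c': "c' = \<lparr>state = q, input_pos = min (length w + 1) (move_head mi (input_pos c)),
      work_tape = (work_tape c)(work_pos c := g), work_pos = move_head mw (work_pos c),
      out_tape = out_tape c @ u\<rparr>"
    by (auto simp: step_def current_trans_def)
  have "scanned_input w (input_pos c) \<in> input_symbols X"
    by (rule scanned_input_in_input_symbols[OF w])
  with tr step.IH M have "q \<in> states M \<and> g \<in> work_alphabet M"
    unfolding wf_transducer_def input_symbols_def by blast
  with step.IH show ?case by (auto simp: c')
qed

lemma reachable_blank: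
  assumes c: "reachable M w c" and W: "\<And>c. reachable M w c \<Longrightarrow> work_pos c \<le> W"
  shows "W < i \<Longrightarrow> work_tape c i = blank M"
  using c unfolding reachable_def
proof (induction rule: rtranclp_induct)
  case base
  then show ?case by (simp add: init_config_def)
next
  case (step c c')
  then have "work_pos c \<noteq> i" using W[of c] by (auto simp: reachable_def)
  with step show ?case by (auto simp: step_def)
qed

text \<open>
  The real-valued logarithmic bound in terms of powers of natural numbers.
\<close>

lemma logspace_transducer_bound:
  assumes "logspace_transducer X Y M"
  shows "\<exists>k. \<forall>w \<in> lists X. \<exists>W. 2 ^ (W + 1) \<le> (length w + 2) ^ k \<and>
    (\<forall>c. reachable M w c \<longrightarrow> work_pos c \<le> W)"
proof -
  from assms obtain \<kappa> where \<kappa>: "\<And>w c. w \<in> lists X \<Longrightarrow> reachable M w c \<Longrightarrow>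
      real (work_pos c + 1) \<le> \<kappa> * log 2 (real (length w + 2))"
    unfolding logspace_transducer_def by blast
  define k where "k = nat \<lceil>\<kappa>\<rceil>"
  have pos: "2 ^ (work_pos c + 1) \<le> (length w + 2) ^ k" if "w \<in> lists X" "reachable M w c" for w c
  proof -
    let ?N = "real (length w + 2)"
    have "real (work_pos c + 1) \<le> \<kappa> * log 2 ?N" using \<kappa> that .
    also have "\<dots> \<le> real k * log 2 ?N"
      unfolding k_def by (intro mult_right_mono) (auto intro: real_nat_ceiling_ge)
    finally have "2 powr real (work_pos c + 1) \<le> 2 powr (real k * log 2 ?N)"
      by (rule powr_mono) simp
    also have "\<dots> = ?N ^ k"
      by (simp add: mult.commute[of "real k"] powr_powr[symmetric] powr_realpow)
    also have "2 powr real (work_pos c + 1) = 2 ^ (work_pos c + 1)" by (rule powr_realpow) simp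
    finally have "real (2 ^ (work_pos c + 1)) \<le> real ((length w + 2) ^ k)" by simp
    then show ?thesis by (simp only: of_nat_le_iff)
  qed
  have "\<exists>W. 2 ^ (W + 1) \<le> (length w + 2) ^ k \<and> (\<forall>c. reachable M w c \<longrightarrow> work_pos c \<le> W)"
    if w: "w \<in> lists X" for w
  proof -
    have "work_pos c < (length w + 2) ^ k" if "reachable M w c" for c
      using pos[OF w that] less_exp[of "work_pos c + 1"] by linarith
    then have "\<exists>c. reachable M w c \<and> (\<forall>c'. reachable M w c' \<longrightarrow> work_pos c' \<le> work_pos c)"
      using ex_has_greatest_nat[where P = "reachable M w" and f = work_pos] reachable_init by metis
    then show ?thesis using pos[OF w] by blast
  qed
  then show ?thesis by blast
qed

text \<open>
  The part of a configuration on which the further run depends.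
\<close>

definition frame :: "('q, 'g, 'y) config \<Rightarrow> 'q \<times> nat \<times> nat \<times> (nat \<Rightarrow> 'g)" where
  "frame c = (state c, input_pos c, work_pos c, work_tape c)"

definition halts_in :: "('q, 'g, 'x, 'y) transducer \<Rightarrow> 'x list \<Rightarrow> nat \<Rightarrow> ('q, 'g, 'y) config \<Rightarrow> bool"
  where "halts_in M w k c \<longleftrightarrow> (\<exists>c'. (step M w ^^ k) c c' \<and> halted M w c')"

lemma halts_in_0: "halts_in M w 0 c \<longleftrightarrow> halted M w c"
  by (simp add: halts_in_def)

lemma halts_in_Suc: "halts_in M w (Suc k) c \<longleftrightarrow> (\<exists>d. step M w c d \<and> halts_in M w k d)"
  unfolding halts_in_def by (auto simp: relpowp_commute[symmetric] dest: relpowp_Suc_D2 intro: relpowp_Suc_I2)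

lemma halted_frame: "frame c = frame d \<Longrightarrow> halted M w c \<longleftrightarrow> halted M w d"
  by (auto simp: frame_def halted_def current_trans_def)

lemma step_frame: "step M w c c' \<Longrightarrow> frame c = frame d \<Longrightarrow> \<exists>d'. step M w d d' \<and> frame c' = frame d'"
  by (force simp: frame_def step_def current_trans_def)

lemma halts_in_frame: "halts_in M w k c \<Longrightarrow> frame c = frame d \<Longrightarrow> halts_in M w k d"
proof (induction k arbitrary: c d)
  case 0
  then show ?case using halted_frame by (auto simp: halts_in_0)
next
  case (Suc k)
  then show ?case by (metis halts_in_Suc step_frame)
qed

lemma halts_in_unique: "halts_in M w k c \<Longrightarrow> halts_in M w l c \<Longrightarrow> k = l"
proof (induction k arbitrary: c l)
  case 0
  then show ?case by (cases l) (auto simp: halts_in_0 halts_in_Suc halted_no_step)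
next
  case (Suc k)
  then show ?case
    by (cases l) (auto simp: halts_in_0 halts_in_Suc halted_no_step dest: step_deterministic)
qed

lemma finite_and_card_tapes:
  fixes A :: "'g set" and W :: nat and bl :: 'g
  assumes "finite A"
  defines "T \<equiv> {t. (\<forall>i. t i \<in> A) \<and> (\<forall>i > W. t i = bl)}"
  shows "finite T \<and> card T \<le> card A ^ (W + 1)"
proof -
  let ?P = "PiE {..W} (\<lambda>_. A)" and ?e = "\<lambda>t i. if i \<le> W then t i else bl"
  have "T \<subseteq> ?e ` ?P"
  proof
    fix t assume "t \<in> T"
    then have "restrict t {..W} \<in> ?P" "t = ?e (restrict t {..W})" by (auto simp: T_def fun_eq_iff)
    then show "t \<in> ?e ` ?P" by blast
  qed
  moreover have "finite ?P" using assms(1) by (intro finite_PiE) auto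
  ultimately have "finite T" "card T \<le> card ?P"
    by (auto intro: finite_subset dest: surj_card_le)
  then show ?thesis by (simp add: card_PiE)
qed

text \<open>
  Along a halting run the number of steps that remain is determined by the frame, so
  distinct times have distinct frames.
\<close>

lemma run_length_le:
  assumes M: "wf_transducer X Y M" and w: "w \<in> lists X"
    and W: "\<And>c. reachable M w c \<Longrightarrow> work_pos c \<le> W"
    and run: "(step M w ^^ k) (init_config M) c" "halted M w c"
  shows "k < card (states M) * ((length w + 2) * ((W + 1) * card (work_alphabet M) ^ (W + 1)))"
proof -
  from run(1) obtain f where f: "f 0 = init_config M" "f k = c"
    and st: "\<And>i. i < k \<Longrightarrow> step M w (f i) (f (Suc i))"
    unfolding relpowp_fun_conv by blast
  have reach: "reachable M w (f i)" if "i \<le> k" for i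
    using that
  proof (induction i)
    case (Suc i)
    then show ?case using reachable_step[OF _ st[of i]] by simp
  qed (simp add: f reachable_init)
  have halts: "halts_in M w i (f (k - i))" if "i \<le> k" for i
    using that
  proof (induction i)
    case 0
    then show ?case using run(2) f by (simp add: halts_in_0)
  next
    case (Suc i)
    then have "step M w (f (k - Suc i)) (f (k - i))" using st[of "k - Suc i"] by (simp add: Suc_diff_Suc)
    with Suc show ?case by (auto simp: halts_in_Suc)
  qed
  have "inj_on (\<lambda>i. frame (f i)) {..k}"
  proof (rule inj_onI)
    fix i j assume "i \<in> {..k}" "j \<in> {..k}" "frame (f i) = frame (f j)"
    then have "k - i = k - j"
      using halts[of "k - i"] halts[of "k - j"] by (auto dest: halts_in_frame halts_in_unique)
    then show "i = j" using \<open>i \<in> {..k}\<close> \<open>j \<in> {..k}\<close> by auto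
  qed
  moreover define T where "T = {t. (\<forall>i. t i \<in> work_alphabet M) \<and> (\<forall>i > W. t i = blank M)}"
  have "(\<lambda>i. frame (f i)) ` {..k} \<subseteq> states M \<times> {..length w + 1} \<times> {..W} \<times> T"
    using reachable_wf[OF M w reach] W[OF reach] reachable_blank[OF reach W]
    by (auto simp: frame_def T_def)
  moreover have T: "finite T" "card T \<le> card (work_alphabet M) ^ (W + 1)"
    using finite_and_card_tapes[of "work_alphabet M" W "blank M"] M
    by (auto simp: T_def wf_transducer_def)
  moreover have "finite (states M)" using M by (simp add: wf_transducer_def)
  ultimately have "card {..k} \<le> card (states M \<times> {..length w + 1} \<times> {..W} \<times> T)"
    by (intro card_inj_on_le) auto
  also have "\<dots> \<le> card (states M) * ((length w + 2) * ((W + 1) * card (work_alphabet M) ^ (W + 1)))"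
    using T(2) unfolding card_cartesian_product card_atMost by (intro mult_le_mono) simp_all
  finally show ?thesis by simp
qed

lemma output_length_le:
  assumes "\<And>c c'. step M w c c' \<Longrightarrow> reachable M w c \<Longrightarrow> length (out_tape c') \<le> length (out_tape c) + m"
    and "(step M w ^^ k) (init_config M) c"
  shows "length (out_tape c) \<le> m * k"
  using assms(2)
proof (induction k arbitrary: c)
  case 0
  then show ?case by (auto simp: init_config_def)
next
  case (Suc k)
  then obtain d where d: "(step M w ^^ k) (init_config M) d" "step M w d c" by auto
  then have "reachable M w d" unfolding reachable_def by (blast intro: relpowp_imp_rtranclp)
  with assms(1)[OF d(2)] Suc.IH[OF d(1)] show ?case by simp
qed

lemma logspace_output_polynomial:
  assumes M: "logspace_transducer X Y M"
  shows "\<exists>d. \<forall>w \<in> lists X. \<forall>v. outputs M w v \<longrightarrow> length v \<le> (length w + 2) ^ d"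
proof -
  have wf: "wf_transducer X Y M" using M by (simp add: logspace_transducer_def)
  obtain k where k: "\<And>w. w \<in> lists X \<Longrightarrow> \<exists>W. 2 ^ (W + 1) \<le> (length w + 2) ^ k \<and>
      (\<forall>c. reachable M w c \<longrightarrow> work_pos c \<le> W)"
    using logspace_transducer_bound[OF M] by blast
  from wf obtain m where m: "\<And>q a g q' g' mi mw u. q \<in> states M \<Longrightarrow> a \<in> input_symbols X \<Longrightarrow>
      g \<in> work_alphabet M \<Longrightarrow> trans M q a g = Some (q', g', mi, mw, u) \<Longrightarrow> length u \<le> m"
    unfolding wf_transducer_def input_symbols_def by metis
  let ?Q = "card (states M)" and ?A = "card (work_alphabet M)"
  define d where "d = m + ?Q + 1 + k + ?A * k"
  have "length v \<le> (length w + 2) ^ d" if w: "w \<in> lists X" and v: "outputs M w v" for w v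
  proof -
    define N where "N = length w + 2"
    have N: "a \<le> N ^ a" for a
      using less_exp[of a] power_mono[of 2 N a] by (simp add: N_def)
    obtain W where W: "2 ^ (W + 1) \<le> N ^ k" "\<And>c. reachable M w c \<Longrightarrow> work_pos c \<le> W"
      using k[OF w] unfolding N_def by blast
    from v obtain c where c: "reachable M w c" "halted M w c" "out_tape c = v"
      by (auto simp: outputs_def halted_def)
    then obtain l where l: "(step M w ^^ l) (init_config M) c"
      by (auto simp: reachable_def rtranclp_power)
    have "length (out_tape c') \<le> length (out_tape c) + m" if "step M w c c'" "reachable M w c" for c c'
      using that reachable_wf[OF wf w that(2)] scanned_input_in_input_symbols[OF w]
      by (force simp: step_def current_trans_def dest: m[rotated 3])
    then have "length v \<le> m * l" using output_length_le[OF _ l] c(3) by blast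
    also have "\<dots> \<le> m * (?Q * (N * ((W + 1) * ?A ^ (W + 1))))"
      using run_length_le[OF wf w W(2) l c(2)]
      by (intro mult_le_mono2) (auto simp: N_def)
    also have "\<dots> \<le> N ^ m * (N ^ ?Q * (N ^ 1 * (N ^ k * N ^ (?A * k))))"
    proof (intro mult_le_mono N)
      show "N \<le> N ^ 1" by simp
      show "W + 1 \<le> N ^ k" using less_exp[of "W + 1"] W(1) by linarith
      have "?A ^ (W + 1) \<le> (2 ^ ?A) ^ (W + 1)" using less_exp[of ?A] by (intro power_mono) auto
      also have "\<dots> = (2 ^ (W + 1)) ^ ?A" by (simp only: power_mult[symmetric] mult.commute)
      also have "\<dots> \<le> (N ^ k) ^ ?A" using W(1) by (intro power_mono) auto
      also have "\<dots> = N ^ (?A * k)" by (simp only: power_mult[symmetric] mult.commute)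
      finally show "?A ^ (W + 1) \<le> N ^ (?A * k)" .
    qed
    also have "\<dots> = N ^ d" by (simp only: power_add[symmetric] d_def add.assoc)
    finally show ?thesis by (simp add: N_def)
  qed
  then show ?thesis by blast
qed

section \<open>Counter programs simulate transducers\<close>

text \<open>
  The work tape is split at the head into two stacks of base-\<open>b\<close> digits, each kept in a register: the
  squares to the left, and the scanned square with those to the right up to \<open>W\<close>, beyond which
  no square is ever visited. With logarithmically many squares these numbers are polynomially bounded. The blank
  symbol has code \<open>0\<close>, so an empty tape is described by two zeros.

  Registers: \<open>0\<close> is set as long as the machine has not halted, \<open>1\<close> holds the state, \<open>2\<close> and
  \<open>3\<close> the positions on the input and work tape, \<open>4\<close> and \<open>5\<close> the two stacks; \<open>6\<close> and \<open>7\<close> are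
  auxiliary.
\<close>

definition sym_code :: "nat \<Rightarrow> nat \<Rightarrow> nat" where
  "sym_code bl g = (if g = bl then 0 else Suc g)"

definition sym_decode :: "nat \<Rightarrow> nat \<Rightarrow> nat" where
  "sym_decode bl d = (if d = 0 then bl else d - 1)"

lemma sym_decode_code [simp]: "sym_decode bl (sym_code bl g) = g"
  by (simp add: sym_code_def sym_decode_def)

lemma sym_code_blank [simp]: "sym_code bl bl = 0"
  by (simp add: sym_code_def)

lemma horner_sum_less:
  fixes b :: nat
  assumes "\<And>x. x \<in> set xs \<Longrightarrow> f x < b"
  shows "horner_sum f b xs < b ^ length xs"
  using assms
proof (induction xs)
  case (Cons x xs)
  then have "horner_sum f b xs < b ^ length xs" "f x < b" by simp_all
  then have "f x + b * horner_sum f b xs < b * Suc (horner_sum f b xs)" by simp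
  also have "\<dots> \<le> b * b ^ length xs"
    using \<open>horner_sum f b xs < b ^ length xs\<close> by (intro mult_le_mono2) simp
  finally show ?case by simp
qed simp

lemma horner_sum_zero:
  fixes b :: nat
  shows "(\<And>x. x \<in> set xs \<Longrightarrow> f x = 0) \<Longrightarrow> horner_sum f b xs = 0"
  by (induction xs) simp_all

definition left_of :: "nat \<Rightarrow> nat \<Rightarrow> (nat \<Rightarrow> nat) \<Rightarrow> nat \<Rightarrow> nat" where
  "left_of bl b T p = horner_sum (sym_code bl) b (rev (map T [0..<p]))"

definition right_of :: "nat \<Rightarrow> nat \<Rightarrow> nat \<Rightarrow> (nat \<Rightarrow> nat) \<Rightarrow> nat \<Rightarrow> nat" where
  "right_of bl b W T p = horner_sum (sym_code bl) b (map T [p..<Suc W])"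

lemma left_of_0 [simp]: "left_of bl b T 0 = 0"
  by (simp add: left_of_def)

lemma left_of_Suc [simp]: "left_of bl b T (Suc p) = sym_code bl (T p) + b * left_of bl b T p"
  by (simp add: left_of_def)

lemma right_of_rec:
  "p \<le> W \<Longrightarrow> right_of bl b W T p = sym_code bl (T p) + b * right_of bl b W T (Suc p)"
  by (simp add: right_of_def upt_conv_Cons del: upt_Suc)

lemma left_of_upd [simp]: "p \<le> i \<Longrightarrow> left_of bl b (T(i := g)) p = left_of bl b T p"
  unfolding left_of_def
  by (intro arg_cong[where f = "horner_sum _ _"] arg_cong[where f = rev] map_cong) auto

lemma right_of_upd [simp]: "i < p \<Longrightarrow> right_of bl b W (T(i := g)) p = right_of bl b W T p"
  unfolding right_of_def by (intro arg_cong[where f = "horner_sum _ _"] map_cong) auto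

lemma left_of_less: "(\<And>i. sym_code bl (T i) < b) \<Longrightarrow> left_of bl b T p < b ^ p"
  using horner_sum_less[of "rev (map T [0..<p])" "sym_code bl" b] by (auto simp: left_of_def)

lemma right_of_less: "(\<And>i. sym_code bl (T i) < b) \<Longrightarrow> right_of bl b W T p < b ^ (Suc W - p)"
  using horner_sum_less[of "map T [p..<Suc W]" "sym_code bl" b] by (auto simp: right_of_def simp del: upt_Suc)

definition sim_store :: "nat \<Rightarrow> nat \<Rightarrow> nat \<Rightarrow> nat \<Rightarrow> nat \<Rightarrow> nat \<Rightarrow> nat \<Rightarrow> nat" where
  "sim_store run q i p L R = (\<lambda>_. 0)(0 := run, 1 := q, 2 := i, 3 := p, 4 := L, 5 := R)"

lemma sim_store_simps [simp]:
  "sim_store run q i p L R 0 = run"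
  "sim_store run q i p L R (Suc 0) = q"
  "sim_store run q i p L R 2 = i"
  "sim_store run q i p L R 3 = p"
  "sim_store run q i p L R 4 = L"
  "sim_store run q i p L R 5 = R"
  "5 < r \<Longrightarrow> sim_store run q i p L R r = 0"
  "(sim_store run q i p L R)(0 := a) = sim_store a q i p L R"
  "(sim_store run q i p L R)(Suc 0 := a) = sim_store run a i p L R"
  "(sim_store run q i p L R)(2 := a) = sim_store run q a p L R"
  "(sim_store run q i p L R)(3 := a) = sim_store run q i a L R"
  "(sim_store run q i p L R)(4 := a) = sim_store run q i p a R"
  "(sim_store run q i p L R)(5 := a) = sim_store run q i p L a"
  by (auto simp: sim_store_def fun_eq_iff)

text \<open>
  The scanned symbol tells when the head must not move past the right end marker.
\<close>

fun move_input :: "'x input_symbol \<Rightarrow> move \<Rightarrow> ('x, 'y) com" where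
  "move_input a MoveLeft = Cond 2 (Dec 2) Skip"
| "move_input a Stay = Skip"
| "move_input a MoveRight = (if a = RightEnd then Skip else Inc 2)"

text \<open>
  The scanned symbol has been popped and is replaced by \<open>d\<close>. For a move to the left the top digit
  of the left stack is moved to the right stack, unless the head is at the leftmost square.
\<close>

fun move_work :: "nat \<Rightarrow> nat \<Rightarrow> move \<Rightarrow> ('x, 'y) com" where
  "move_work b d MoveLeft = push 5 7 b d ;;
     Cond 3 (Dec 3 ;; pop 4 7 6 b ;; add_mult 5 7 b ;; add_mult 7 5 1 ;; add_mult 6 5 1) Skip"
| "move_work b d Stay = push 5 7 b d"
| "move_work b d MoveRight = push 4 7 b d ;; Inc 3"

lemma exec_move_input:
  assumes "i \<le> length w + 1" "length w + 1 < B"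
  shows "exec B w (move_input (scanned_input w i) mi) (sim_store run q i p L R) []
    (sim_store run q (min (length w + 1) (move_head mi i)) p L R)"
proof (cases mi)
  case MoveLeft
  show ?thesis
  proof (cases i)
    case 0
    then show ?thesis using MoveLeft by (auto intro!: exec.CondF exec.Skip)
  next
    case (Suc j)
    then show ?thesis using MoveLeft assms by (auto intro!: exec.CondT exec_Dec)
  qed
next
  case Stay
  then show ?thesis using assms by (simp add: exec.Skip min_absorb2)
next
  case MoveRight
  show ?thesis
  proof (cases "i = length w + 1")
    case True
    then show ?thesis using MoveRight by (simp add: scanned_input_def exec.Skip)
  next
    case False
    then have "scanned_input w i \<noteq> RightEnd" using assms by (auto simp: scanned_input_def)
    moreover have "exec B w (Inc 2) (sim_store run q i p L R) [] (sim_store run q (Suc i) p L R)"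
      using assms False by (intro exec_Inc) auto
    ultimately show ?thesis using MoveRight assms False by (auto simp: min_absorb2)
  qed
qed

lemma exec_move_work_stay:
  assumes "d + b * R < B"
  shows "exec B w (move_work b d Stay) (sim_store run q i p L R) [] (sim_store run q i p L (d + b * R))"
  using assms by (auto intro!: exec_push)

lemma exec_move_work_right:
  assumes "d + b * L < B" "Suc p < B"
  shows "exec B w (move_work b d MoveRight) (sim_store run q i p L R) []
    (sim_store run q i (Suc p) (d + b * L) R)"
  unfolding move_work.simps using assms
  by (intro exec_Seq[OF exec_push[OF _ _ _ refl] exec_Inc]) auto

lemma exec_move_work_left_0:
  assumes "d + b * R < B"
  shows "exec B w (move_work b d MoveLeft) (sim_store run q i 0 L R) []
    (sim_store run q i 0 L (d + b * R))"
  unfolding move_work.simps using assms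
  by (intro exec_Seq[OF exec_push[OF _ _ _ refl] exec.CondF] exec.Skip) (auto intro!: exec.Skip)

lemma exec_move_work_left_Suc:
  fixes w :: "'x list"
  assumes "e < b" "e + b * L < B" "e + b * (d + b * R) < B" "d + b * R < B" "b < B"
  shows "exec B w (move_work b d MoveLeft :: ('x, 'y) com) (sim_store run q i (Suc p) (e + b * L) R) []
    (sim_store run q i p L (e + b * (d + b * R)))"
proof -
  let ?R = "d + b * R"
  let ?s = "\<lambda>p L R m t. (sim_store run q i p L R)(6 := m, 7 := t)"
  have [simp]: "?s p L R 0 0 = sim_store run q i p L R" for p L R
    by (auto simp: fun_eq_iff)
  have "1 * L \<le> b * L" using assms(1) by (intro mult_le_mono1) auto
  then have LB: "L < B" using assms(2) by linarith
  have e: "(e + b * L) div b = L" "(e + b * L) mod b = e" using assms(1) by auto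
  have 1: "exec B w (push 5 7 b d :: ('x, 'y) com) (sim_store run q i (Suc p) (e + b * L) R) []
      (sim_store run q i (Suc p) (e + b * L) ?R)"
    using assms by (intro exec_push) auto
  have 2: "exec B w (pop 4 7 6 b :: ('x, 'y) com) (sim_store run q i p (e + b * L) ?R) [] (?s p L ?R e 0)"
    using assms by (intro exec_pop) (auto simp: e fun_eq_iff)
  have 3: "exec B w (add_mult 5 7 b :: ('x, 'y) com) (?s p L ?R e 0) [] (?s p L 0 e (b * ?R))"
    using assms by (intro exec_add_mult) (auto simp: fun_eq_iff sim_store_def)
  have 4: "exec B w (add_mult 7 5 1 :: ('x, 'y) com) (?s p L 0 e (b * ?R)) [] (?s p L (b * ?R) e 0)"
    using assms by (intro exec_add_mult) (auto simp: fun_eq_iff sim_store_def)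
  have 5: "exec B w (add_mult 6 5 1 :: ('x, 'y) com) (?s p L (b * ?R) e 0) [] (?s p L (e + b * ?R) 0 0)"
    using assms by (intro exec_add_mult) (auto simp: fun_eq_iff sim_store_def)
  have "exec B w (pop 4 7 6 b ;; add_mult 5 7 b ;; add_mult 7 5 1 ;; add_mult 6 5 1 :: ('x, 'y) com)
      (sim_store run q i p (e + b * L) ?R) [] (?s p L (e + b * ?R) 0 0)"
    by (rule exec_Seq[OF 2 exec_Seq[OF 3 exec_Seq[OF 4 5]]]) simp_all
  then have "exec B w (Dec 3 ;; pop 4 7 6 b ;; add_mult 5 7 b ;; add_mult 7 5 1 ;; add_mult 6 5 1 :: ('x, 'y) com)
      (sim_store run q i (Suc p) (e + b * L) ?R) [] (sim_store run q i p L (e + b * ?R))"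
    by (intro exec_Dec_Seq[where k = p]) simp_all
  then show ?thesis
    unfolding move_work.simps by (intro exec_Seq[OF 1 exec.CondT]) auto
qed

text \<open>
  There is a branch for every number below the bounds on states and codes, and some of these are
  not states or codes. There the transition function is unconstrained, and a branch that consults
  it might output letters outside \<open>Y\<close>.
\<close>

definition sim_branch ::
    "(nat, nat, 'x, 'y) transducer \<Rightarrow> nat \<Rightarrow> 'x input_symbol \<Rightarrow> nat \<Rightarrow> nat \<Rightarrow> ('x, 'y) com" where
  "sim_branch M b a q d =
     (if q \<in> states M \<and> sym_decode (blank M) d \<in> work_alphabet M
      then case trans M q a (sym_decode (blank M) d) of
          None \<Rightarrow> Dec 0
        | Some (q', g', mi, mw, u) \<Rightarrow>
            outs u ;; incs 1 q' ;; move_input a mi ;; move_work b (sym_code (blank M) g') mw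
      else Skip)"

text \<open>
  One step of the machine. Switching on the state clears its register, and the branch fills in the
  next state.
\<close>

definition sim_body :: "(nat, nat, 'x, 'y) transducer \<Rightarrow> nat \<Rightarrow> nat \<Rightarrow> ('x, 'y) com" where
  "sim_body M b n =
     copy 2 6 7 ;;
     Read 6 (\<lambda>a. pop 5 7 6 b ;;
       switch 1 (map (\<lambda>q. switch 6 (map (sim_branch M b a q) [0..<b])) [0..<n]))"

lemma wf_move_input: "wf_com X Y 8 (move_input a mi)"
  by (cases mi) auto

lemma wf_move_work: "wf_com X Y 8 (move_work b d mw)"
  by (cases mw) auto

lemma wf_sim_branch:
  assumes "wf_transducer X Y M" "a \<in> input_symbols X"
  shows "wf_com X Y 8 (sim_branch M b a q d)"
proof (cases "q \<in> states M \<and> sym_decode (blank M) d \<in> work_alphabet M")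
  case True
  have "u \<in> lists Y" if "trans M q a (sym_decode (blank M) d) = Some (q', g', mi, mw, u)" for q' g' mi mw u
    using assms True that unfolding wf_transducer_def input_symbols_def by metis
  then show ?thesis
    by (auto simp: sim_branch_def wf_move_input wf_move_work simp del: in_lists_conv_set split: option.split)
qed (auto simp: sim_branch_def)

lemma wf_sim_body: "wf_transducer X Y M \<Longrightarrow> wf_com X Y 8 (sim_body M b n)"
  by (auto simp: sim_body_def wf_sim_branch)

lemma exec_sim_body:
  fixes w :: "'x list" and M :: "(nat, nat, 'x, 'y) transducer"
  assumes "i < B" "q < n" "d < b" "d + b * R < B" "b < B"
    and branch: "exec B w (sim_branch M b (scanned_input w i) q d) (sim_store 1 0 i p L R) u t"
  shows "exec B w (sim_body M b n) (sim_store 1 q i p L (d + b * R)) u t"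
proof -
  let ?s = "sim_store 1 q i p L (d + b * R)" and ?a = "scanned_input w i"
  let ?s1 = "(sim_store 1 q i p L R)(6 := d)" and ?s2 = "(sim_store 1 0 i p L R)(6 := d)"
  let ?cs = "map (sim_branch M b ?a q) [0..<b]"
  let ?bs = "map (\<lambda>q. switch 6 (map (sim_branch M b ?a q) [0..<b])) [0..<n]"
  have 1: "exec B w (copy 2 6 7 :: ('x, 'y) com) ?s [] (?s(6 := i))"
    using assms by (intro exec_copy) auto
  have "(d + b * R) div b = R" "(d + b * R) mod b = d" using assms(3) by auto
  then have 2: "exec B w (pop 5 7 6 b :: ('x, 'y) com) ?s [] ?s1"
    using assms by (intro exec_pop) (auto simp: fun_eq_iff sim_store_def)
  have "?s2(6 := 0) = sim_store 1 0 i p L R" by (auto simp: fun_eq_iff)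
  then have 3: "exec B w (switch 6 ?cs) ?s2 u t"
    using assms(3) branch by (intro exec_switch) auto
  have "?s1(1 := 0) = ?s2" by (auto simp: fun_eq_iff sim_store_def)
  then have 4: "exec B w (switch 1 ?bs) ?s1 u t"
    using assms(2) 3 by (intro exec_switch) auto
  have "(?s(6 := i))(6 := 0) = ?s" by (auto simp: fun_eq_iff)
  then have "exec B w (Read 6 (\<lambda>a. pop 5 7 6 b ;;
      switch 1 (map (\<lambda>q. switch 6 (map (sim_branch M b a q) [0..<b])) [0..<n]))) (?s(6 := i)) u t"
    using exec_Seq[OF 2 4] by (intro exec.Read) simp
  with 1 show ?thesis unfolding sim_body_def by (rule exec_Seq) simp
qed

definition config_store ::
    "(nat, nat, 'x, 'y) transducer \<Rightarrow> nat \<Rightarrow> nat \<Rightarrow> (nat, nat, 'y) config \<Rightarrow> nat \<Rightarrow> nat" where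
  "config_store M b W c =
     sim_store 1 (state c) (input_pos c) (work_pos c)
       (left_of (blank M) b (work_tape c) (work_pos c))
       (right_of (blank M) b W (work_tape c) (work_pos c))"

text \<open>
  Every number stays below \<open>b ^ (W + 1)\<close> because the two stacks together describe \<open>W + 1\<close> squares.
\<close>

lemma exec_sim_round:
  fixes w :: "'x list" and M :: "(nat, nat, 'x, 'y) transducer"
  assumes M: "wf_transducer X Y M" and w: "w \<in> lists X" and c: "reachable M w c"
    and W: "\<And>c. reachable M w c \<Longrightarrow> work_pos c \<le> W"
    and n: "\<And>q. q \<in> states M \<Longrightarrow> q < n"
    and b: "\<And>g. g \<in> work_alphabet M \<Longrightarrow> sym_code (blank M) g < b"
    and B: "n < B" "b < B" "length w + 1 < B" "W < B" "b ^ (W + 1) \<le> B"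
  shows exec_sim_step: "step M w c c' \<Longrightarrow> \<exists>u. out_tape c' = out_tape c @ u \<and>
      exec B w (sim_body M b n) (config_store M b W c) u (config_store M b W c')"
    and exec_sim_halt: "halted M w c \<Longrightarrow>
      \<exists>t. t 0 = 0 \<and> exec B w (sim_body M b n) (config_store M b W c) [] t"
proof -
  let ?q = "state c" and ?i = "input_pos c" and ?p = "work_pos c" and ?T = "work_tape c"
  let ?bl = "blank M"
  let ?d = "sym_code ?bl (?T ?p)" and ?a = "scanned_input w ?i"
  let ?L = "left_of ?bl b ?T ?p" and ?R = "right_of ?bl b W ?T (Suc ?p)"
  have inv: "?q \<in> states M" "\<And>i. ?T i \<in> work_alphabet M" "?i \<le> length w + 1"
    using reachable_wf[OF M w c] by auto
  have p: "?p \<le> W" using W[OF c] .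
  have b0: "0 < b" using b inv(2) by fastforce
  have pow: "b ^ j \<le> B" if "j \<le> W + 1" for j
    using power_increasing[OF that, of b] b0 B(5) by linarith
  have left_B: "left_of ?bl b T j < B" if "j \<le> W + 1" "\<And>i. T i \<in> work_alphabet M" for T j
  proof -
    have "left_of ?bl b T j < b ^ j" by (rule left_of_less) (rule b, rule that(2))
    then show ?thesis using pow[OF that(1)] by linarith
  qed
  have right_B: "right_of ?bl b W T j < B" if "\<And>i. T i \<in> work_alphabet M" for T j
  proof -
    have "right_of ?bl b W T j < b ^ (Suc W - j)" by (rule right_of_less) (rule b, rule that)
    then show ?thesis using pow[of "Suc W - j"] by simp
  qed
  have store: "config_store M b W c = sim_store 1 ?q ?i ?p ?L (?d + b * ?R)"
    using right_of_rec[OF p] by (simp add: config_store_def)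
  have dR: "?d + b * ?R < B" using right_B[of ?T ?p] inv(2) right_of_rec[OF p] by simp
  have body: "exec B w (sim_body M b n) (config_store M b W c) u t"
    if "exec B w (sim_branch M b ?a ?q ?d) (sim_store 1 0 ?i ?p ?L ?R) u t" for u t
    unfolding store using that inv n b B dR by (intro exec_sim_body) auto
  have branch: "sim_branch M b ?a ?q ?d = (case current_trans M w c of None \<Rightarrow> Dec 0
      | Some (q', g', mi, mw, u) \<Rightarrow>
          outs u ;; incs 1 q' ;; move_input ?a mi ;; move_work b (sym_code ?bl g') mw)"
    using inv by (simp add: sim_branch_def current_trans_def)
  {
    assume "step M w c c'"
    then obtain q' g' mi mw u where tr: "current_trans M w c = Some (q', g', mi, mw, u)"
      and c': "c' = \<lparr>state = q', input_pos = min (length w + 1) (move_head mi ?i),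
        work_tape = ?T(?p := g'), work_pos = move_head mw ?p, out_tape = out_tape c @ u\<rparr>"
      by (auto simp: step_def)
    have reach': "reachable M w c'" using reachable_step[OF c \<open>step M w c c'\<close>] .
    have inv': "q' \<in> states M" "\<And>i. (?T(?p := g')) i \<in> work_alphabet M"
      using reachable_wf[OF M w reach'] by (auto simp: c')
    have g': "g' \<in> work_alphabet M" using inv'(2)[of ?p] by simp
    let ?T' = "?T(?p := g')" and ?d' = "sym_code ?bl g'" and ?i' = "min (length w + 1) (move_head mi ?i)"
    have dR': "?d' + b * ?R < B"
      using right_B[of ?T' ?p, OF inv'(2)] right_of_rec[OF p, of ?bl b ?T'] by simp
    have q'B: "q' < B" using n[OF inv'(1)] B(1) by simp
    have 1: "exec B w (incs 1 q' :: ('x, 'y) com) (sim_store 1 0 ?i ?p ?L ?R) []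
        (sim_store 1 q' ?i ?p ?L ?R)"
      using q'B by (intro exec_incs) auto
    have 2: "exec B w (move_input ?a mi :: ('x, 'y) com) (sim_store 1 q' ?i ?p ?L ?R) []
        (sim_store 1 q' ?i' ?p ?L ?R)"
      using inv(3) B(3) by (rule exec_move_input)
    have 3: "exec B w (move_work b ?d' mw :: ('x, 'y) com) (sim_store 1 q' ?i' ?p ?L ?R) []
        (config_store M b W c')"
    proof (cases mw)
      case Stay
      have "config_store M b W c' = sim_store 1 q' ?i' ?p ?L (?d' + b * ?R)"
        using p by (simp add: config_store_def c' Stay right_of_rec)
      then show ?thesis using exec_move_work_stay[OF dR'] Stay by simp
    next
      case MoveRight
      have "Suc ?p \<le> W" using W[OF reach'] by (simp add: c' MoveRight)
      have "config_store M b W c' = sim_store 1 q' ?i' (Suc ?p) (?d' + b * ?L) ?R"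
        by (simp add: config_store_def c' MoveRight)
      moreover have "?d' + b * ?L < B"
        using left_B[of "Suc ?p" ?T', OF _ inv'(2)] p by simp
      ultimately show ?thesis
        using exec_move_work_right[of ?d' b ?L B ?p] MoveRight B(4) \<open>Suc ?p \<le> W\<close> by simp
    next
      case MoveLeft
      show ?thesis
      proof (cases ?p)
        case 0
        then have "config_store M b W c' = sim_store 1 q' ?i' 0 ?L (?d' + b * ?R)"
          by (simp add: config_store_def c' MoveLeft right_of_rec)
        then show ?thesis using exec_move_work_left_0[OF dR'] MoveLeft 0 by simp
      next
        case (Suc j)
        let ?e = "sym_code ?bl (?T j)" and ?L' = "left_of ?bl b ?T j"
        have "right_of ?bl b W ?T' j = ?e + b * (?d' + b * ?R)"
          using p Suc by (simp add: right_of_rec)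
        then have "config_store M b W c' = sim_store 1 q' ?i' j ?L' (?e + b * (?d' + b * ?R))"
          and "?e + b * (?d' + b * ?R) < B"
          using right_B[of ?T' j, OF inv'(2)] by (simp_all add: config_store_def c' MoveLeft Suc)
        moreover have "?L = ?e + b * ?L'" using Suc by simp
        moreover have "?e + b * ?L' < B"
          using left_B[of "Suc j" ?T, OF _ inv(2)] p Suc by simp
        ultimately show ?thesis
          using exec_move_work_left_Suc[of ?e b ?L' B ?d' ?R] b[OF inv(2)] dR' B(2) MoveLeft Suc
          by simp
      qed
    qed
    have "exec B w (sim_branch M b ?a ?q ?d) (sim_store 1 0 ?i ?p ?L ?R) u (config_store M b W c')"
      unfolding branch tr option.case prod.case
      by (rule exec_Seq[OF exec_outs exec_Seq[OF 1 exec_Seq[OF 2 3]]]) simp_all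
    then have "out_tape c' = out_tape c @ u \<and>
        exec B w (sim_body M b n) (config_store M b W c) u (config_store M b W c')"
      using body by (simp add: c')
    then show "\<exists>u. out_tape c' = out_tape c @ u \<and>
        exec B w (sim_body M b n) (config_store M b W c) u (config_store M b W c')" ..
  }
  {
    assume "halted M w c"
    then have "exec B w (sim_branch M b ?a ?q ?d) (sim_store 1 0 ?i ?p ?L ?R) []
        (sim_store 0 0 ?i ?p ?L ?R)"
      unfolding branch halted_def by (auto intro!: exec_Dec)
    from body[OF this] show "\<exists>t. t 0 = 0 \<and> exec B w (sim_body M b n) (config_store M b W c) [] t"
      by (intro exI conjI) auto
  }
qed

lemma exec_sim_loop:
  fixes w :: "'x list" and M :: "(nat, nat, 'x, 'y) transducer"
  assumes M: "wf_transducer X Y M" and w: "w \<in> lists X"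
    and W: "\<And>c. reachable M w c \<Longrightarrow> work_pos c \<le> W"
    and n: "\<And>q. q \<in> states M \<Longrightarrow> q < n"
    and b: "\<And>g. g \<in> work_alphabet M \<Longrightarrow> sym_code (blank M) g < b"
    and B: "n < B" "b < B" "length w + 1 < B" "W < B" "b ^ (W + 1) \<le> B"
    and run: "(step M w)\<^sup>*\<^sup>* c c'" "reachable M w c" "halted M w c'"
  shows "\<exists>u t. out_tape c' = out_tape c @ u \<and>
    exec B w (While 0 (sim_body M b n)) (config_store M b W c) u t"
  using run(1,2)
proof (induction rule: converse_rtranclp_induct)
  case base
  then obtain t where t: "t 0 = 0" "exec B w (sim_body M b n) (config_store M b W c') [] t"
    using exec_sim_halt[OF M w _ W n b B] run(3) by blast
  then have "exec B w (While 0 (sim_body M b n)) (config_store M b W c') ([] @ []) t"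
    by (intro exec.WhileT[OF _ t(2) exec.WhileF]) (auto simp: config_store_def)
  then show ?case by auto
next
  case (step c d)
  obtain u where u: "out_tape d = out_tape c @ u"
      "exec B w (sim_body M b n) (config_store M b W c) u (config_store M b W d)"
    using exec_sim_step[OF M w step.prems W n b B step.hyps(1)] by blast
  obtain v t where v: "out_tape c' = out_tape d @ v"
      "exec B w (While 0 (sim_body M b n)) (config_store M b W d) v t"
    using step.IH reachable_step[OF step.prems step.hyps(1)] by blast
  have "exec B w (While 0 (sim_body M b n)) (config_store M b W c) (u @ v) t"
    using u(2) v(2) by (intro exec.WhileT) (auto simp: config_store_def)
  then show ?case using u(1) v(1) by auto
qed

theorem logspace_imp_while_computable:
  fixes f :: "'x list \<Rightarrow> 'y list"
  assumes "logspace_computable X Y S f"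
  shows "while_computable X Y S f"
proof -
  from assms obtain M :: "(nat, nat, 'x, 'y) transducer"
    where M: "logspace_transducer X Y M" and out: "\<And>w. w \<in> S \<Longrightarrow> outputs M w (f w)"
    unfolding logspace_computable_def by blast
  have SX: "S \<subseteq> lists X" using assms by (simp add: logspace_computable_def)
  have wf: "wf_transducer X Y M" using M by (simp add: logspace_transducer_def)
  obtain d where d: "\<And>w v. w \<in> lists X \<Longrightarrow> outputs M w v \<Longrightarrow> length v \<le> (length w + 2) ^ d"
    using logspace_output_polynomial[OF M] by blast
  obtain k where k: "\<And>w. w \<in> lists X \<Longrightarrow> \<exists>W. 2 ^ (W + 1) \<le> (length w + 2) ^ k \<and>
      (\<forall>c. reachable M w c \<longrightarrow> work_pos c \<le> W)"
    using logspace_transducer_bound[OF M] by blast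
  obtain n where n: "\<And>q. q \<in> states M \<Longrightarrow> q < n"
    using wf finite_nat_set_iff_bounded[of "states M"] by (auto simp: wf_transducer_def)
  have "finite (sym_code (blank M) ` work_alphabet M)" using wf by (simp add: wf_transducer_def)
  then obtain b where b: "\<And>g. g \<in> work_alphabet M \<Longrightarrow> sym_code (blank M) g < b"
    unfolding finite_nat_set_iff_bounded by blast
  let ?c = "Inc 0 ;; incs 1 (init M) ;; While 0 (sim_body M b n)"
  define D where "D = d + n + b + 1 + k + k * b"
  have "length (f w) \<le> (length w + 2) ^ D \<and>
      (\<exists>t. exec ((length w + 2) ^ D) w ?c (\<lambda>_. 0) (f w) t)" if wS: "w \<in> S" for w
  proof -
    have w: "w \<in> lists X" using wS SX by blast
    define N where "N = length w + 2"
    have grow: "N ^ e \<le> N ^ D" if "e \<le> D" for e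
      using that by (intro power_increasing) (auto simp: N_def)
    have less: "a < N ^ a" for a
      using less_exp[of a] power_mono[of 2 N a] unfolding N_def by linarith
    obtain W where W: "2 ^ (W + 1) \<le> N ^ k" "\<And>c. reachable M w c \<Longrightarrow> work_pos c \<le> W"
      using k[OF w] unfolding N_def by blast
    have B1: "n < N ^ D" using less[of n] grow[of n] by (simp add: D_def)
    have B2: "b < N ^ D" using less[of b] grow[of b] by (simp add: D_def)
    have B3: "length w + 1 < N ^ D" using grow[of 1] by (simp add: D_def N_def)
    have B4: "W < N ^ D" using less_exp[of "W + 1"] W(1) grow[of k] by (simp add: D_def)
    have "b ^ (W + 1) \<le> (2 ^ b) ^ (W + 1)" using less_exp[of b] by (intro power_mono) auto
    also have "\<dots> = (2 ^ (W + 1)) ^ b" by (simp only: power_mult[symmetric] mult.commute)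
    also have "\<dots> \<le> (N ^ k) ^ b" using W(1) by (intro power_mono) auto
    also have "\<dots> = N ^ (k * b)" by (simp only: power_mult)
    also have "\<dots> \<le> N ^ D" by (rule grow) (simp add: D_def)
    finally have B5: "b ^ (W + 1) \<le> N ^ D" .
    from out[OF wS] obtain c where c: "reachable M w c" "halted M w c" "out_tape c = f w"
      by (auto simp: outputs_def halted_def)
    obtain u t where u: "out_tape c = out_tape (init_config M) @ u"
        "exec (N ^ D) w (While 0 (sim_body M b n)) (config_store M b W (init_config M)) u t"
      using exec_sim_loop[OF wf w W(2) n b B1 B2 B3 B4 B5 _ reachable_init c(2)] c(1)
      unfolding reachable_def by blast
    have "u = f w" using u(1) c(3) by (simp add: init_config_def)
    have "right_of (blank M) b W (\<lambda>_. blank M) 0 = 0"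
      unfolding right_of_def by (rule horner_sum_zero) auto
    then have store: "config_store M b W (init_config M) = sim_store 1 (init M) 0 0 0 0"
      by (simp add: config_store_def init_config_def)
    have "init M < N ^ D" using n[of "init M"] wf B1 by (auto simp: wf_transducer_def)
    then have "exec (N ^ D) w (incs 1 (init M) :: ('x, 'y) com) (sim_store 1 0 0 0 0 0) []
        (sim_store 1 (init M) 0 0 0 0)"
      by (intro exec_incs) auto
    moreover have "exec (N ^ D) w (Inc 0 :: ('x, 'y) com) (\<lambda>_. 0) [] (sim_store 1 0 0 0 0 0)"
      using B3 by (intro exec_Inc) (auto simp: sim_store_def fun_eq_iff)
    ultimately have "exec (N ^ D) w ?c (\<lambda>_. 0) (f w) t"
      using u(2) unfolding store \<open>u = f w\<close> by (auto intro!: exec_Seq)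
    moreover have "length (f w) \<le> N ^ D"
      using d[OF w out[OF wS]] grow[of d] by (simp add: D_def N_def)
    ultimately show ?thesis unfolding N_def by blast
  qed
  moreover have "wf_com X Y 8 ?c" using wf_sim_body[OF wf] by simp
  ultimately show ?thesis
    using assms unfolding while_computable_def logspace_computable_def by blast
qed

section \<open>Transducers execute counter programs\<close>

text \<open>
  Square \<open>i\<close> of the work tape holds bit \<open>i\<close> of every register at once, as the set of those registers
  in which the bit is set. The squares in use are marked as visited, the first one also as leftmost.
  Increments, decrements and tests for zero are sweeps from the left end that
  stop at the first suitable bit, after which the head returns.

  A control state is either a list of programs still to be run or one phase of an
  elementary operation together with the control state that follows it.
\<close>

datatype tag = Visited | LeftMost | Bit nat

datatype ('x, 'y) control =
    Start "('x, 'y) com"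
  | Run "('x, 'y) com list"
  | IncAt nat "('x, 'y) control"
  | DecAt nat "('x, 'y) control"
  | TestAt nat "('x, 'y) control" "('x, 'y) control"
  | Rewind "('x, 'y) control"
  | HomeInput "('x, 'y) control"
  | NextInput "('x, 'y) control"
  | Seek nat "'x input_symbol \<Rightarrow> ('x, 'y) com" "('x, 'y) com list"
  | Branch "'x input_symbol \<Rightarrow> ('x, 'y) com" "('x, 'y) com list"

text \<open>
  To read the letter whose position is the value of \<open>r\<close>, the input head is sent to the left end
  marker, and then advances once for each decrement of \<open>r\<close>.
\<close>

fun control_trans :: "('x, 'y) control \<Rightarrow> 'x input_symbol \<Rightarrow> tag set \<Rightarrow>
    (('x, 'y) control \<times> tag set \<times> move \<times> move \<times> 'y list) option" where
  "control_trans (Start c) a g = Some (Run [c], {Visited, LeftMost}, Stay, Stay, [])"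
| "control_trans (Run []) a g = None"
| "control_trans (Run (Skip # k)) a g = Some (Run k, g, Stay, Stay, [])"
| "control_trans (Run (Inc r # k)) a g = Some (IncAt r (Run k), g, Stay, Stay, [])"
| "control_trans (Run (Dec r # k)) a g = Some (DecAt r (Run k), g, Stay, Stay, [])"
| "control_trans (Run (Out y # k)) a g = Some (Run k, g, Stay, Stay, [y])"
| "control_trans (Run ((c1 ;; c2) # k)) a g = Some (Run (c1 # c2 # k), g, Stay, Stay, [])"
| "control_trans (Run (Cond r c1 c2 # k)) a g =
     Some (TestAt r (Run (c1 # k)) (Run (c2 # k)), g, Stay, Stay, [])"
| "control_trans (Run (While r c # k)) a g =
     Some (TestAt r (Run (c # While r c # k)) (Run k), g, Stay, Stay, [])"
| "control_trans (Run (Read r F # k)) a g = Some (HomeInput (Seek r F k), g, Stay, Stay, [])"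
| "control_trans (IncAt r q) a g =
     (if Bit r \<in> g then Some (IncAt r q, g - {Bit r}, Stay, MoveRight, [])
      else Some (Rewind q, insert Visited (insert (Bit r) g), Stay, Stay, []))"
| "control_trans (DecAt r q) a g =
     (if Bit r \<in> g then Some (Rewind q, g - {Bit r}, Stay, Stay, [])
      else Some (DecAt r q, insert (Bit r) g, Stay, MoveRight, []))"
| "control_trans (TestAt r q1 q2) a g =
     (if Bit r \<in> g then Some (Rewind q1, g, Stay, Stay, [])
      else if Visited \<in> g then Some (TestAt r q1 q2, g, Stay, MoveRight, [])
      else Some (Rewind q2, g, Stay, Stay, []))"
| "control_trans (Rewind q) a g =
     (if LeftMost \<in> g then Some (q, g, Stay, Stay, [])
      else Some (Rewind q, g, Stay, MoveLeft, []))"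
| "control_trans (HomeInput q) a g =
     (if a = LeftEnd then Some (q, g, Stay, Stay, [])
      else Some (HomeInput q, g, MoveLeft, Stay, []))"
| "control_trans (NextInput q) a g = Some (q, g, MoveRight, Stay, [])"
| "control_trans (Seek r F k) a g =
     Some (TestAt r (DecAt r (NextInput (Seek r F k))) (Branch F k), g, Stay, Stay, [])"
| "control_trans (Branch F k) a g = Some (Run (F a # k), g, Stay, Stay, [])"

definition compile :: "('x, 'y) control set \<Rightarrow> nat \<Rightarrow> ('x, 'y) com \<Rightarrow>
    (('x, 'y) control, tag set, 'x, 'y) transducer" where
  "compile Q K c = \<lparr>states = Q, init = Start c,
     work_alphabet = Pow ({Visited, LeftMost} \<union> Bit ` {..<K}), blank = {}, trans = control_trans\<rparr>"

text \<open>
  The control states that occur while \<open>c\<close> is run with continuation \<open>k\<close>. This set is finite because a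
  loop returns to one and the same continuation.
\<close>

primrec controls :: "'x set \<Rightarrow> ('x, 'y) com \<Rightarrow> ('x, 'y) com list \<Rightarrow> ('x, 'y) control set" where
  "controls X Skip k = {Run (Skip # k)}"
| "controls X (Inc r) k = {Run (Inc r # k), IncAt r (Run k), Rewind (Run k)}"
| "controls X (Dec r) k = {Run (Dec r # k), DecAt r (Run k), Rewind (Run k)}"
| "controls X (Out y) k = {Run (Out y # k)}"
| "controls X (c1 ;; c2) k =
     {Run ((c1 ;; c2) # k)} \<union> controls X c1 (c2 # k) \<union> controls X c2 k"
| "controls X (Cond r c1 c2) k =
     {Run (Cond r c1 c2 # k), TestAt r (Run (c1 # k)) (Run (c2 # k)),
      Rewind (Run (c1 # k)), Rewind (Run (c2 # k))} \<union> controls X c1 k \<union> controls X c2 k"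
| "controls X (While r c) k =
     {Run (While r c # k), TestAt r (Run (c # While r c # k)) (Run k),
      Rewind (Run (c # While r c # k)), Rewind (Run k)} \<union> controls X c (While r c # k)"
| "controls X (Read r F) k =
     (let q = Seek r F k; d = DecAt r (NextInput q) in
       {Run (Read r F # k), HomeInput q, q, TestAt r d (Branch F k), Rewind d, d,
        Rewind (NextInput q), NextInput q, Rewind (Branch F k), Branch F k}
       \<union> (\<Union>a \<in> input_symbols X. controls X (F a) k))"

lemma finite_controls: "finite X \<Longrightarrow> finite (controls X c k)"
  by (induction c arbitrary: k) (auto simp: Let_def)

lemma Run_in_controls [simp]: "Run (c # k) \<in> controls X c k"
  by (cases c) (auto simp: Let_def)

lemma controls_closed:
  assumes "q \<in> controls X c k" "wf_com X Y K c" "a \<in> input_symbols X"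
    and "g \<in> Pow ({Visited, LeftMost} \<union> Bit ` {..<K})"
    and "control_trans q a g = Some (q', g', mi, mw, u)"
  shows "q' \<in> controls X c k \<union> {Run k} \<and> g' \<in> Pow ({Visited, LeftMost} \<union> Bit ` {..<K}) \<and>
    u \<in> lists Y \<and> length u \<le> 1"
  using assms(1,2,5)
proof (induction c arbitrary: k)
  case (Seq c1 c2)
  from Seq.prems(1) consider "q = Run ((c1 ;; c2) # k)" | "q \<in> controls X c1 (c2 # k)" | "q \<in> controls X c2 k"
    by auto
  then show ?case
  proof cases
    case 1
    then show ?thesis using Seq.prems(3) assms(4) by auto
  next
    case 2
    then show ?thesis using Seq.IH(1)[OF 2] Seq.prems(2,3) by auto
  next
    case 3
    then show ?thesis using Seq.IH(2)[OF 3] Seq.prems(2,3) by auto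
  qed
next
  case (Cond r c1 c2)
  from Cond.prems(1) consider "q \<in> {Run (Cond r c1 c2 # k), TestAt r (Run (c1 # k)) (Run (c2 # k)),
      Rewind (Run (c1 # k)), Rewind (Run (c2 # k))}" | "q \<in> controls X c1 k" | "q \<in> controls X c2 k"
    by auto
  then show ?case
  proof cases
    case 1
    then show ?thesis using Cond.prems(3) assms(4) by (auto split: if_splits)
  next
    case 2
    then show ?thesis using Cond.IH(1)[OF 2] Cond.prems(2,3) by auto
  next
    case 3
    then show ?thesis using Cond.IH(2)[OF 3] Cond.prems(2,3) by auto
  qed
next
  case (While r c)
  from While.prems(1) consider "q \<in> {Run (While r c # k), TestAt r (Run (c # While r c # k)) (Run k),
      Rewind (Run (c # While r c # k)), Rewind (Run k)}" | "q \<in> controls X c (While r c # k)"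
    by auto
  then show ?case
  proof cases
    case 1
    then show ?thesis using While.prems(3) assms(4) by (auto split: if_splits)
  next
    case 2
    then show ?thesis using While.IH[OF 2] While.prems(2,3) by auto
  qed
next
  case (Read r F)
  let ?q = "Seek r F k"
  let ?d = "DecAt r (NextInput ?q)"
  from Read.prems(1) consider "q \<in> {Run (Read r F # k), HomeInput ?q, ?q, TestAt r ?d (Branch F k),
      Rewind ?d, ?d, Rewind (NextInput ?q), NextInput ?q, Rewind (Branch F k), Branch F k}"
    | b where "b \<in> input_symbols X" "q \<in> controls X (F b) k"
    by (auto simp: Let_def)
  then show ?case
  proof cases
    case 1
    have "\<exists>b \<in> input_symbols X. Run (F a # k) \<in> controls X (F b) k"
      using assms(3) by (intro bexI[of _ a]) simp_all
    with 1 show ?thesis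
      using Read.prems(2,3) assms(4) by (auto simp: Let_def split: if_splits)
  next
    case 2
    then show ?thesis
      using Read.IH[OF _ 2(2)] Read.prems(2,3) by (auto simp: Let_def)
  qed
qed (use assms(4) in \<open>auto split: if_splits\<close>)

definition program_controls :: "'x set \<Rightarrow> ('x, 'y) com \<Rightarrow> ('x, 'y) control set" where
  "program_controls X c = {Start c, Run []} \<union> controls X c []"

lemma wf_compile:
  assumes "finite X" "finite Y" "wf_com X Y K c"
  shows "wf_transducer X Y (compile (program_controls X c) K c)"
proof -
  let ?A = "Pow ({Visited, LeftMost} \<union> Bit ` {..<K})"
  have closed: "q' \<in> program_controls X c \<and> g' \<in> ?A \<and> u \<in> lists Y \<and> length u \<le> 1"
    if "q \<in> program_controls X c" "a \<in> input_symbols X" "g \<in> ?A"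
      and tr: "control_trans q a g = Some (q', g', mi, mw, u)" for q a g q' g' mi mw u
  proof -
    from that(1) consider "q = Start c" | "q = Run []" | "q \<in> controls X c []"
      by (auto simp: program_controls_def)
    then show ?thesis
    proof cases
      case 3
      then show ?thesis
        using controls_closed[OF 3 assms(3) that(2,3) tr] by (auto simp: program_controls_def)
    qed (use tr in \<open>auto simp: program_controls_def\<close>)
  qed
  show ?thesis
    using assms(1,2) finite_controls[OF assms(1), of c "[]"]
    unfolding wf_transducer_def compile_def transducer.simps input_symbols_def[symmetric]
    by (intro conjI exI[of _ 1] ballI allI impI)
      (use closed in \<open>blast | simp add: program_controls_def\<close>)+
qed

lemma nat_less_power_of_2_iff: "(y::nat) < 2 ^ m \<longleftrightarrow> (\<forall>i. bit y i \<longrightarrow> i < m)"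
proof -
  have "y < 2 ^ m \<longleftrightarrow> take_bit m y = y" by (simp add: take_bit_nat_eq_self_iff)
  also have "\<dots> \<longleftrightarrow> (\<forall>i. bit y i \<longrightarrow> i < m)" by (auto simp: bit_eq_iff bit_take_bit_iff)
  finally show ?thesis .
qed

lemma bit_add_power: "\<not> bit (y::nat) j \<Longrightarrow> bit (y + 2 ^ j) i \<longleftrightarrow> i = j \<or> bit y i"
  using bit_set_bit_iff[of j y i] by (auto simp: set_bit_eq)

lemma power_le_of_bit: "bit (y::nat) j \<Longrightarrow> 2 ^ j \<le> y"
  using nat_less_power_of_2_iff[of y j] by (meson linorder_not_less nless_le)

lemma bit_diff_power:
  assumes "bit (y::nat) j"
  shows "bit (y - 2 ^ j) i \<longleftrightarrow> i \<noteq> j \<and> bit y i"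
proof -
  have "y = set_bit j (unset_bit j y)"
    using assms by (intro bit_eqI) (auto simp: bit_set_bit_iff bit_unset_bit_iff)
  also have "\<dots> = unset_bit j y + 2 ^ j"
    by (simp add: set_bit_eq bit_unset_bit_iff)
  finally have "y = unset_bit j y + 2 ^ j" .
  then have "y - 2 ^ j = unset_bit j y" by linarith
  then show ?thesis by (auto simp: bit_unset_bit_iff)
qed

definition store_tape :: "nat \<Rightarrow> (nat \<Rightarrow> nat) \<Rightarrow> nat \<Rightarrow> tag set" where
  "store_tape m s = (\<lambda>i. if i < m
     then {Visited} \<union> (if i = 0 then {LeftMost} else {}) \<union> {Bit r | r. bit (s r) i} else {})"

text \<open>
  The tape \<open>store_tape m s\<close> determines \<open>s\<close> only if all bits lie in its first \<open>m\<close> squares; at least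
  one square is needed for the mark of the left end.
\<close>

definition fits :: "nat \<Rightarrow> (nat \<Rightarrow> nat) \<Rightarrow> bool" where
  "fits m s \<longleftrightarrow> 1 \<le> m \<and> (\<forall>r. s r < 2 ^ m)"

lemma fits_bit: "fits m s \<Longrightarrow> bit (s r) i \<Longrightarrow> i < m"
  by (simp add: fits_def nat_less_power_of_2_iff)

lemma Bit_in_store_tape: "fits m s \<Longrightarrow> Bit r \<in> store_tape m s i \<longleftrightarrow> bit (s r) i"
  using fits_bit by (auto simp: store_tape_def)

lemma store_tape_clear:
  assumes "bit (s r) j"
  shows "(store_tape m s)(j := store_tape m s j - {Bit r}) = store_tape m (s(r := s r - 2 ^ j))"
proof -
  have "(store_tape m s)(j := store_tape m s j - {Bit r}) = store_tape m (s(r := y))"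
    if "\<And>i. bit y i \<longleftrightarrow> i \<noteq> j \<and> bit (s r) i" for y
    by (auto simp: store_tape_def fun_eq_iff that)
  then show ?thesis using bit_diff_power[OF assms] by blast
qed

lemma store_tape_set:
  assumes "\<not> bit (s r) j" "j < m"
  shows "(store_tape m s)(j := insert (Bit r) (store_tape m s j)) = store_tape m (s(r := s r + 2 ^ j))"
proof -
  have "(store_tape m s)(j := insert (Bit r) (store_tape m s j)) = store_tape m (s(r := y))"
    if "\<And>i. bit y i \<longleftrightarrow> i = j \<or> bit (s r) i" for y
    using assms(2) by (auto simp: store_tape_def fun_eq_iff that)
  then show ?thesis using bit_add_power[OF assms(1)] by blast
qed

lemma store_tape_extend:
  assumes "fits m s"
  shows "(store_tape m s)(m := {Visited, Bit r}) = store_tape (Suc m) (s(r := s r + 2 ^ m))"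
proof
  fix i
  have no: "\<not> bit (s r') m" for r' using fits_bit[OF assms, of r' m] by auto
  show "((store_tape m s)(m := {Visited, Bit r})) i = store_tape (Suc m) (s(r := s r + 2 ^ m)) i"
    using assms no by (auto simp: store_tape_def fits_def bit_add_power less_Suc_eq split: if_splits)
qed

lemma fits_clear: "fits m s \<Longrightarrow> fits m (s(r := s r - 2 ^ j))"
  by (auto simp: fits_def intro: le_less_trans[OF diff_le_self])

lemma fits_set: "fits m s \<Longrightarrow> \<not> bit (s r) j \<Longrightarrow> j < m \<Longrightarrow> fits m (s(r := s r + 2 ^ j))"
  by (auto simp: fits_def nat_less_power_of_2_iff bit_add_power)

lemma fits_extend: "fits m s \<Longrightarrow> fits (Suc m) (s(r := s r + 2 ^ m))"
proof -
  assume m: "fits m s"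
  then have "s r' < 2 ^ Suc m" for r' by (auto simp: fits_def intro: less_trans)
  with m show ?thesis by (auto simp: fits_def)
qed

definition store_config ::
    "('x, 'y) control \<Rightarrow> nat \<Rightarrow> nat \<Rightarrow> (nat \<Rightarrow> nat) \<Rightarrow> nat \<Rightarrow> 'y list \<Rightarrow>
     (('x, 'y) control, tag set, 'y) config" where
  "store_config q i m s j u =
     \<lparr>state = q, input_pos = i, work_tape = store_tape m s, work_pos = j, out_tape = u\<rparr>"

definition runs_within ::
    "('q, 'g, 'x, 'y) transducer \<Rightarrow> 'x list \<Rightarrow> nat \<Rightarrow> ('q, 'g, 'y) config \<Rightarrow> ('q, 'g, 'y) config \<Rightarrow> bool"
  where
  "runs_within M w L = (\<lambda>c c'. step M w c c' \<and> work_pos c \<le> L \<and> work_pos c' \<le> L)\<^sup>*\<^sup>*"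

lemma runs_within_refl [simp]: "runs_within M w L c c"
  by (simp add: runs_within_def)

lemma runs_within_trans [trans]:
  "runs_within M w L c d \<Longrightarrow> runs_within M w L d e \<Longrightarrow> runs_within M w L c e"
  unfolding runs_within_def by (rule rtranclp_trans)

text \<open>
  By determinism, a halting run passes through every reachable configuration.
\<close>

lemma runs_within_reachable:
  assumes "runs_within M w L c c'" "halted M w c'" "work_pos c' \<le> L" "(step M w)\<^sup>*\<^sup>* c d"
  shows "work_pos d \<le> L"
  using assms(1,4) unfolding runs_within_def
proof (induction rule: converse_rtranclp_induct)
  case base
  then have "d = c'" using assms(2) by (auto elim: converse_rtranclpE dest: halted_no_step)
  then show ?case using assms(3) by simp
next
  case (step c e)
  from step.prems show ?case
  proof (cases rule: converse_rtranclpE)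
    case base
    then show ?thesis using step.hyps(1) by simp
  next
    case (step f)
    then have "f = e" using step_deterministic \<open>step M w c e \<and> _\<close> by blast
    then show ?thesis using step.IH step by blast
  qed
qed

lemma runs_within_step:
  assumes M: "trans M = control_trans"
    and "control_trans q (scanned_input w i) (store_tape m s j) = Some (q', g', mi, mw, v)"
    and "(store_tape m s)(j := g') = store_tape m' s'" "j \<le> L" "move_head mw j \<le> L"
    and "i' = min (length w + 1) (move_head mi i)"
  shows "runs_within M w L (store_config q i m s j u)
    (store_config q' i' m' s' (move_head mw j) (u @ v))"
  unfolding runs_within_def
  by (rule r_into_rtranclp)
     (use assms in \<open>auto simp: step_def current_trans_def store_config_def\<close>)

context
  fixes M :: "(('x, 'y) control, tag set, 'x, 'y) transducer" and w :: "'x list" and L :: nat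
  assumes M: "trans M = control_trans"
begin

lemma runs_within_quiet:
  assumes "control_trans q (scanned_input w i) (store_tape m s j) =
      Some (q', store_tape m s j, Stay, mw, [])"
    and "j \<le> L" "move_head mw j \<le> L" "i \<le> length w + 1"
  shows "runs_within M w L (store_config q i m s j u) (store_config q' i m s (move_head mw j) u)"
  using runs_within_step[OF M assms(1), of m s L i u] assms by (simp add: min_absorb2)

lemma runs_within_rewind:
  assumes "fits m s" "i \<le> length w + 1"
  shows "j \<le> L \<Longrightarrow> runs_within M w L (store_config (Rewind q) i m s j u) (store_config q i m s 0 u)"
proof (induction j)
  case 0
  then show ?case
    using runs_within_quiet[of "Rewind q" i m s 0 q Stay u] assms by (simp add: store_tape_def fits_def)
next
  case (Suc j)
  have "runs_within M w L (store_config (Rewind q) i m s (Suc j) u) (store_config (Rewind q) i m s j u)"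
    using runs_within_quiet[of "Rewind q" i m s "Suc j" "Rewind q" MoveLeft u] assms Suc.prems
    by (simp add: store_tape_def)
  also have "runs_within M w L \<dots> (store_config q i m s 0 u)" using Suc by simp
  finally show ?case .
qed

text \<open>
  A sweep that has arrived at square \<open>j\<close> has \<open>2 ^ j\<close> left to add: adding it sets bit \<open>j\<close> if this is
  clear; otherwise bit \<open>j\<close> is cleared, which subtracts \<open>2 ^ j\<close>, and \<open>2 ^ (j + 1)\<close> is left to add. A carry
  out of the visited squares visits one more.
\<close>

lemma runs_within_inc:
  assumes "i \<le> length w + 1" "m \<le> L"
  shows "fits m s \<Longrightarrow> j \<le> m \<Longrightarrow> s r + 2 ^ j < 2 ^ L \<Longrightarrow>
    \<exists>m'. m' \<le> L \<and> fits m' (s(r := s r + 2 ^ j)) \<and>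
      runs_within M w L (store_config (IncAt r q) i m s j u)
        (store_config q i m' (s(r := s r + 2 ^ j)) 0 u)"
proof (induction "m - j" arbitrary: j s)
  case 0
  then have j: "j = m" by simp
  have "\<not> bit (s r) m" using fits_bit[OF 0(2), of r m] by auto
  have "(2::nat) ^ m < 2 ^ L" using 0(4) unfolding j by linarith
  then have mL: "m < L" by simp
  have "runs_within M w L (store_config (IncAt r q) i m s m u)
      (store_config (Rewind q) i (Suc m) (s(r := s r + 2 ^ m)) m u)"
    using runs_within_step[OF M, of "IncAt r q" w i m s m "Rewind q" "{Visited, Bit r}" Stay Stay "[]"
        "Suc m" "s(r := s r + 2 ^ m)" L i u]
      store_tape_extend[OF 0(2)] mL assms by (simp add: store_tape_def min_absorb2)
  also have "runs_within M w L \<dots> (store_config q i (Suc m) (s(r := s r + 2 ^ m)) 0 u)"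
    using fits_extend[OF 0(2)] mL assms by (intro runs_within_rewind) auto
  finally have runs: "runs_within M w L (store_config (IncAt r q) i m s m u)
      (store_config q i (Suc m) (s(r := s r + 2 ^ m)) 0 u)" .
  show ?case
    unfolding j by (intro exI conjI) (rule Suc_leI[OF mL], rule fits_extend[OF 0(2)], rule runs)
next
  case (Suc k)
  then have j: "j < m" by simp
  have Vis: "Visited \<in> store_tape m s j" using j by (simp add: store_tape_def)
  show ?case
  proof (cases "bit (s r) j")
    case True
    let ?s = "s(r := s r - 2 ^ j)"
    have le: "2 ^ j \<le> s r" using power_le_of_bit[OF True] .
    have eq: "?s(r := ?s r + 2 ^ Suc j) = s(r := s r + 2 ^ j)"
      using le by (auto simp: fun_eq_iff)
    have "\<exists>m'. m' \<le> L \<and> fits m' (?s(r := ?s r + 2 ^ Suc j)) \<and>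
      runs_within M w L (store_config (IncAt r q) i m ?s (Suc j) u)
        (store_config q i m' (?s(r := ?s r + 2 ^ Suc j)) 0 u)"
      using Suc.hyps(2) j Suc.prems fits_clear[OF Suc.prems(1)] le by (intro Suc.hyps(1)) auto
    then obtain m' where m': "m' \<le> L" "fits m' (s(r := s r + 2 ^ j))"
      "runs_within M w L (store_config (IncAt r q) i m ?s (Suc j) u)
        (store_config q i m' (s(r := s r + 2 ^ j)) 0 u)"
      unfolding eq by blast
    have runs: "runs_within M w L (store_config (IncAt r q) i m s j u)
        (store_config (IncAt r q) i m ?s (Suc j) u)"
      using runs_within_step[OF M, of "IncAt r q" w i m s j "IncAt r q" "store_tape m s j - {Bit r}"
          Stay MoveRight "[]" m ?s L i u] store_tape_clear[of s r j m, OF True]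
        Bit_in_store_tape[OF Suc.prems(1)] True j assms by (simp add: min_absorb2)
    show ?thesis
      by (intro exI conjI) (rule m'(1), rule m'(2), rule runs_within_trans[OF runs m'(3)])
  next
    case False
    let ?s = "s(r := s r + 2 ^ j)"
    have fit: "fits m ?s" using fits_set[OF Suc.prems(1) False j] .
    have "runs_within M w L (store_config (IncAt r q) i m s j u) (store_config (Rewind q) i m ?s j u)"
      using runs_within_step[OF M, of "IncAt r q" w i m s j "Rewind q" "insert (Bit r) (store_tape m s j)"
          Stay Stay "[]" m ?s L i u] store_tape_set[of s r j m, OF False j]
        Bit_in_store_tape[OF Suc.prems(1)] False j assms Vis by (simp add: min_absorb2 insert_absorb)
    also have "runs_within M w L \<dots> (store_config q i m ?s 0 u)"
      using fit j assms by (intro runs_within_rewind) auto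
    finally have runs: "runs_within M w L (store_config (IncAt r q) i m s j u)
        (store_config q i m ?s 0 u)" .
    show ?thesis by (intro exI conjI) (rule assms(2), rule fit, rule runs)
  qed
qed

text \<open>
  As for increments, \<open>2 ^ j\<close> is left to subtract when the sweep arrives at square \<open>j\<close>.
\<close>

lemma runs_within_dec:
  assumes "i \<le> length w + 1" "m \<le> L"
  shows "fits m s \<Longrightarrow> 2 ^ j \<le> s r \<Longrightarrow> fits m (s(r := s r - 2 ^ j)) \<and>
      runs_within M w L (store_config (DecAt r q) i m s j u)
        (store_config q i m (s(r := s r - 2 ^ j)) 0 u)"
proof (induction "m - j" arbitrary: j s rule: less_induct)
  case less
  have "s r < 2 ^ m" using less.prems(1) by (simp add: fits_def)
  then have "(2::nat) ^ j < 2 ^ m" using less.prems(2) by linarith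
  then have j: "j < m" by simp
  show ?case
  proof (cases "bit (s r) j")
    case True
    let ?s = "s(r := s r - 2 ^ j)"
    have fit: "fits m ?s" using fits_clear[OF less.prems(1)] .
    have "runs_within M w L (store_config (DecAt r q) i m s j u) (store_config (Rewind q) i m ?s j u)"
      using runs_within_step[OF M, of "DecAt r q" w i m s j "Rewind q" "store_tape m s j - {Bit r}"
          Stay Stay "[]" m ?s L i u] store_tape_clear[of s r j m, OF True]
        Bit_in_store_tape[OF less.prems(1)] True j assms by (simp add: min_absorb2)
    also have "runs_within M w L \<dots> (store_config q i m ?s 0 u)"
      using fit j assms by (intro runs_within_rewind) auto
    finally have runs: "runs_within M w L (store_config (DecAt r q) i m s j u)
        (store_config q i m ?s 0 u)" .
    show ?thesis by (intro conjI) (rule fit, rule runs)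
  next
    case False
    let ?s = "s(r := s r + 2 ^ j)"
    have fit: "fits m ?s" using fits_set[OF less.prems(1) False j] .
    have eq: "?s(r := ?s r - 2 ^ Suc j) = s(r := s r - 2 ^ j)"
      by (auto simp: fun_eq_iff)
    have "fits m (?s(r := ?s r - 2 ^ Suc j)) \<and>
      runs_within M w L (store_config (DecAt r q) i m ?s (Suc j) u)
        (store_config q i m (?s(r := ?s r - 2 ^ Suc j)) 0 u)"
      using j less.prems fit by (intro less.hyps) auto
    then have rest: "fits m (s(r := s r - 2 ^ j))"
      "runs_within M w L (store_config (DecAt r q) i m ?s (Suc j) u)
        (store_config q i m (s(r := s r - 2 ^ j)) 0 u)"
      unfolding eq by blast+
    have runs: "runs_within M w L (store_config (DecAt r q) i m s j u)
        (store_config (DecAt r q) i m ?s (Suc j) u)"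
      using runs_within_step[OF M, of "DecAt r q" w i m s j "DecAt r q" "insert (Bit r) (store_tape m s j)"
          Stay MoveRight "[]" m ?s L i u] store_tape_set[of s r j m, OF False j]
        Bit_in_store_tape[OF less.prems(1)] False j assms by (simp add: min_absorb2)
    show ?thesis by (intro conjI) (rule rest(1), rule runs_within_trans[OF runs rest(2)])
  qed
qed

lemma runs_within_test:
  assumes "i \<le> length w + 1" "m \<le> L" "fits m s"
  shows "j \<le> m \<Longrightarrow> (\<And>l. l < j \<Longrightarrow> \<not> bit (s r) l) \<Longrightarrow>
    runs_within M w L (store_config (TestAt r q1 q2) i m s j u)
      (store_config (if s r > 0 then q1 else q2) i m s 0 u)"
proof (induction "m - j" arbitrary: j)
  case 0
  then have j: "j = m" by simp
  have "\<not> bit (s r) l" for l using 0(3)[of l] fits_bit[OF assms(3), of r l] j by auto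
  then have "s r = 0" by (intro bit_eqI) simp
  have "runs_within M w L (store_config (TestAt r q1 q2) i m s m u) (store_config (Rewind q2) i m s m u)"
    using runs_within_quiet[of "TestAt r q1 q2" i m s m "Rewind q2" Stay u] assms
    by (simp add: store_tape_def)
  also have "runs_within M w L \<dots> (store_config q2 i m s 0 u)"
    using assms by (intro runs_within_rewind) auto
  finally show ?case using j \<open>s r = 0\<close> by simp
next
  case (Suc k)
  then have j: "j < m" by simp
  have Vis: "Visited \<in> store_tape m s j" using j by (simp add: store_tape_def)
  show ?case
  proof (cases "bit (s r) j")
    case True
    have "runs_within M w L (store_config (TestAt r q1 q2) i m s j u) (store_config (Rewind q1) i m s j u)"
      using runs_within_quiet[of "TestAt r q1 q2" i m s j "Rewind q1" Stay u] assms j True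
      by (simp add: Bit_in_store_tape)
    also have "runs_within M w L \<dots> (store_config q1 i m s 0 u)"
      using assms j by (intro runs_within_rewind) auto
    finally have "runs_within M w L (store_config (TestAt r q1 q2) i m s j u) (store_config q1 i m s 0 u)" .
    moreover have "s r > 0" using True by (cases "s r") auto
    ultimately show ?thesis by simp
  next
    case False
    have "runs_within M w L (store_config (TestAt r q1 q2) i m s j u)
        (store_config (TestAt r q1 q2) i m s (Suc j) u)"
      using runs_within_quiet[of "TestAt r q1 q2" i m s j "TestAt r q1 q2" MoveRight u] assms j False Vis
      by (simp add: Bit_in_store_tape)
    also have "runs_within M w L \<dots> (store_config (if s r > 0 then q1 else q2) i m s 0 u)"
      using Suc False j by (intro Suc.hyps) (auto simp: less_Suc_eq)
    finally show ?thesis .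
  qed
qed

lemma runs_within_home:
  assumes "fits m s" "m \<le> L"
  shows "i \<le> length w + 1 \<Longrightarrow>
    runs_within M w L (store_config (HomeInput q) i m s 0 u) (store_config q 0 m s 0 u)"
proof (induction i)
  case 0
  then show ?case
    using runs_within_quiet[of "HomeInput q" 0 m s 0 q Stay u] by (simp add: scanned_input_def)
next
  case (Suc i)
  have "runs_within M w L (store_config (HomeInput q) (Suc i) m s 0 u) (store_config (HomeInput q) i m s 0 u)"
    using runs_within_step[OF M, of "HomeInput q" w "Suc i" m s 0 "HomeInput q" "store_tape m s 0"
        MoveLeft Stay "[]" m s L i u] Suc.prems
    by (simp add: scanned_input_def min_absorb2)
  also have "runs_within M w L \<dots> (store_config q 0 m s 0 u)" using Suc by simp
  finally show ?case .
qed

lemma scanned_input_min: "scanned_input w (min (length w + 1) i) = scanned_input w i"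
  by (auto simp: scanned_input_def min_def)

lemma runs_within_seek:
  assumes "m \<le> L"
  shows "fits m s \<Longrightarrow> i \<le> length w + 1 \<Longrightarrow>
    fits m (s(r := 0)) \<and> runs_within M w L (store_config (Seek r F k) i m s 0 u)
      (store_config (Branch F k) (min (length w + 1) (i + s r)) m (s(r := 0)) 0 u)"
proof (induction "s r" arbitrary: s i)
  let ?d = "DecAt r (NextInput (Seek r F k))"
  have seek: "runs_within M w L (store_config (Seek r F k) i m s 0 u)
      (store_config (if s r > 0 then ?d else Branch F k) i m s 0 u)"
    if "fits m s" "i \<le> length w + 1" for s i
  proof -
    have "runs_within M w L (store_config (Seek r F k) i m s 0 u)
        (store_config (TestAt r ?d (Branch F k)) i m s 0 u)"
      using runs_within_quiet[of "Seek r F k" i m s 0 "TestAt r ?d (Branch F k)" Stay u] that by simp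
    also have "runs_within M w L \<dots> (store_config (if s r > 0 then ?d else Branch F k) i m s 0 u)"
      using that assms by (intro runs_within_test) auto
    finally show ?thesis .
  qed
  {
    case 0
    then have "s(r := 0) = s" by (auto simp: fun_eq_iff)
    with 0 seek[of s i] show ?case by (simp add: min_absorb2)
  next
    case (Suc x)
    let ?s = "s(r := x)" and ?i = "min (length w + 1) (Suc i)"
    have "runs_within M w L (store_config (Seek r F k) i m s 0 u) (store_config ?d i m s 0 u)"
      using seek[OF Suc.prems] Suc.hyps(2) by simp
    also have dec: "fits m ?s \<and> runs_within M w L (store_config ?d i m s 0 u)
        (store_config (NextInput (Seek r F k)) i m ?s 0 u)"
      using runs_within_dec[of i m s 0 r "NextInput (Seek r F k)" u] Suc.prems Suc.hyps(2)[symmetric] assms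
      by simp
    then have "runs_within M w L (store_config ?d i m s 0 u)
        (store_config (NextInput (Seek r F k)) i m ?s 0 u)" ..
    also have "runs_within M w L \<dots> (store_config (Seek r F k) ?i m ?s 0 u)"
      using runs_within_step[OF M, of "NextInput (Seek r F k)" w i m ?s 0 "Seek r F k" "store_tape m ?s 0"
        MoveRight Stay "[]" m ?s L ?i u] by simp
    finally have 1: "runs_within M w L (store_config (Seek r F k) i m s 0 u)
        (store_config (Seek r F k) ?i m ?s 0 u)" .
    have "fits m (?s(r := 0)) \<and> runs_within M w L (store_config (Seek r F k) ?i m ?s 0 u)
        (store_config (Branch F k) (min (length w + 1) (?i + ?s r)) m (?s(r := 0)) 0 u)"
      using dec by (intro Suc.hyps(1)) auto
    moreover have "min (length w + 1) (?i + ?s r) = min (length w + 1) (i + s r)"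
      using Suc.hyps(2) by (auto simp: min_def)
    ultimately show ?case using 1 by (auto intro: runs_within_trans)
  }
qed

text \<open>
  The bound on values makes \<open>L\<close> squares suffice: a carry into square \<open>L\<close> would produce a value of at
  least \<open>2 ^ L\<close>.
\<close>

lemma runs_within_exec:
  assumes "exec B w c s u t" "B \<le> 2 ^ L"
    and "fits m s" "m \<le> L" "i \<le> length w + 1"
  shows "\<exists>i' m'. fits m' t \<and> m' \<le> L \<and> i' \<le> length w + 1 \<and>
    runs_within M w L (store_config (Run (c # k)) i m s 0 v) (store_config (Run k) i' m' t 0 (v @ u))"
  using assms(1,3-)
proof (induction arbitrary: k i m v rule: exec.induct)
  case (Skip s)
  have "runs_within M w L (store_config (Run (Skip # k)) i m s 0 v) (store_config (Run k) i m s 0 v)"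
    using runs_within_quiet[of "Run (Skip # k)" i m s 0 "Run k" Stay v] Skip by simp
  with Skip show ?case by auto
next
  case (Inc s r)
  have runs: "runs_within M w L (store_config (Run (Inc r # k)) i m s 0 v) (store_config (IncAt r (Run k)) i m s 0 v)"
    using runs_within_quiet[of "Run (Inc r # k)" i m s 0 "IncAt r (Run k)" Stay v] Inc by simp
  have "\<exists>m'. m' \<le> L \<and> fits m' (s(r := s r + 2 ^ 0)) \<and>
      runs_within M w L (store_config (IncAt r (Run k)) i m s 0 v)
        (store_config (Run k) i m' (s(r := s r + 2 ^ 0)) 0 v)"
    using Inc assms(2) by (intro runs_within_inc) auto
  then obtain m' where m': "m' \<le> L" "fits m' (s(r := Suc (s r)))"
      "runs_within M w L (store_config (IncAt r (Run k)) i m s 0 v)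
        (store_config (Run k) i m' (s(r := Suc (s r))) 0 v)"
    unfolding power_0 Suc_eq_plus1[symmetric] by blast
  show ?case
    unfolding append_Nil2
    by (intro exI conjI)
      (rule m'(2), rule m'(1), rule Inc.prems(3), rule runs_within_trans[OF runs m'(3)])
next
  case (Dec s r x)
  have runs: "runs_within M w L (store_config (Run (Dec r # k)) i m s 0 v) (store_config (DecAt r (Run k)) i m s 0 v)"
    using runs_within_quiet[of "Run (Dec r # k)" i m s 0 "DecAt r (Run k)" Stay v] Dec by simp
  have "fits m (s(r := s r - 2 ^ 0)) \<and>
      runs_within M w L (store_config (DecAt r (Run k)) i m s 0 v)
        (store_config (Run k) i m (s(r := s r - 2 ^ 0)) 0 v)"
    using Dec by (intro runs_within_dec) auto
  moreover have "s r - 2 ^ 0 = x" using Dec.hyps by simp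
  ultimately have dec: "fits m (s(r := x))"
      "runs_within M w L (store_config (DecAt r (Run k)) i m s 0 v)
        (store_config (Run k) i m (s(r := x)) 0 v)"
    by (simp_all only:)
  show ?case
    unfolding append_Nil2
    by (intro exI conjI)
      (rule dec(1), rule Dec.prems(2), rule Dec.prems(3), rule runs_within_trans[OF runs dec(2)])
next
  case (Out y s)
  have "runs_within M w L (store_config (Run (Out y # k)) i m s 0 v) (store_config (Run k) i m s 0 (v @ [y]))"
    using runs_within_step[OF M, of "Run (Out y # k)" w i m s 0 "Run k" "store_tape m s 0"
        Stay Stay "[y]" m s L i v] Out by (simp add: min_absorb2)
  with Out show ?case by auto
next
  case (Seq c1 s u s' c2 u' t)
  have "runs_within M w L (store_config (Run ((c1 ;; c2) # k)) i m s 0 v)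
      (store_config (Run (c1 # c2 # k)) i m s 0 v)"
    using runs_within_quiet[of "Run ((c1 ;; c2) # k)" i m s 0 "Run (c1 # c2 # k)" Stay v] Seq.prems by simp
  moreover obtain i1 m1 where 1: "fits m1 s'" "m1 \<le> L" "i1 \<le> length w + 1"
    "runs_within M w L (store_config (Run (c1 # c2 # k)) i m s 0 v)
      (store_config (Run (c2 # k)) i1 m1 s' 0 (v @ u))"
    using Seq.IH(1)[OF Seq.prems] by blast
  moreover obtain i2 m2 where "fits m2 t" "m2 \<le> L" "i2 \<le> length w + 1"
    "runs_within M w L (store_config (Run (c2 # k)) i1 m1 s' 0 (v @ u))
      (store_config (Run k) i2 m2 t 0 ((v @ u) @ u'))"
    using Seq.IH(2)[OF 1(1-3)] by blast
  ultimately show ?case unfolding append_assoc by (meson runs_within_trans)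
next
  case (CondT s r c1 u t c2)
  have "runs_within M w L (store_config (Run (Cond r c1 c2 # k)) i m s 0 v)
      (store_config (TestAt r (Run (c1 # k)) (Run (c2 # k))) i m s 0 v)"
    using runs_within_quiet[of "Run (Cond r c1 c2 # k)" i m s 0 "TestAt r (Run (c1 # k)) (Run (c2 # k))" Stay v]
      CondT.prems by simp
  also have "runs_within M w L \<dots> (store_config (if s r > 0 then Run (c1 # k) else Run (c2 # k)) i m s 0 v)"
    using CondT.prems by (intro runs_within_test) auto
  also have "(if s r > 0 then Run (c1 # k) else Run (c2 # k)) = Run (c1 # k)" using CondT.hyps by simp
  finally show ?case using CondT.IH[OF CondT.prems] by (meson runs_within_trans)
next
  case (CondF s r c2 u t c1)
  have "runs_within M w L (store_config (Run (Cond r c1 c2 # k)) i m s 0 v)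
      (store_config (TestAt r (Run (c1 # k)) (Run (c2 # k))) i m s 0 v)"
    using runs_within_quiet[of "Run (Cond r c1 c2 # k)" i m s 0 "TestAt r (Run (c1 # k)) (Run (c2 # k))" Stay v]
      CondF.prems by simp
  also have "runs_within M w L \<dots> (store_config (if s r > 0 then Run (c1 # k) else Run (c2 # k)) i m s 0 v)"
    using CondF.prems by (intro runs_within_test) auto
  also have "(if s r > 0 then Run (c1 # k) else Run (c2 # k)) = Run (c2 # k)" using CondF.hyps by simp
  finally show ?case using CondF.IH[OF CondF.prems] by (meson runs_within_trans)
next
  case (WhileF s r c)
  have "runs_within M w L (store_config (Run (While r c # k)) i m s 0 v)
      (store_config (TestAt r (Run (c # While r c # k)) (Run k)) i m s 0 v)"
    using runs_within_quiet[of "Run (While r c # k)" i m s 0 "TestAt r (Run (c # While r c # k)) (Run k)" Stay v]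
      WhileF.prems by simp
  also have "runs_within M w L \<dots> (store_config (if s r > 0 then Run (c # While r c # k) else Run k) i m s 0 v)"
    using WhileF.prems by (intro runs_within_test) auto
  also have "(if s r > 0 then Run (c # While r c # k) else Run k) = Run k" using WhileF.hyps by simp
  finally show ?case using WhileF.prems by auto
next
  case (WhileT s r c u s' u' t)
  have "runs_within M w L (store_config (Run (While r c # k)) i m s 0 v)
      (store_config (TestAt r (Run (c # While r c # k)) (Run k)) i m s 0 v)"
    using runs_within_quiet[of "Run (While r c # k)" i m s 0 "TestAt r (Run (c # While r c # k)) (Run k)" Stay v]
      WhileT.prems by simp
  also have "runs_within M w L \<dots> (store_config (if s r > 0 then Run (c # While r c # k) else Run k) i m s 0 v)"
    using WhileT.prems by (intro runs_within_test) auto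
  also have "(if s r > 0 then Run (c # While r c # k) else Run k) = Run (c # While r c # k)"
    using WhileT.hyps by simp
  finally have 0: "runs_within M w L (store_config (Run (While r c # k)) i m s 0 v)
      (store_config (Run (c # While r c # k)) i m s 0 v)" .
  obtain i1 m1 where 1: "fits m1 s'" "m1 \<le> L" "i1 \<le> length w + 1"
    "runs_within M w L (store_config (Run (c # While r c # k)) i m s 0 v)
      (store_config (Run (While r c # k)) i1 m1 s' 0 (v @ u))"
    using WhileT.IH(1)[OF WhileT.prems] by blast
  moreover obtain i2 m2 where "fits m2 t" "m2 \<le> L" "i2 \<le> length w + 1"
    "runs_within M w L (store_config (Run (While r c # k)) i1 m1 s' 0 (v @ u))
      (store_config (Run k) i2 m2 t 0 ((v @ u) @ u'))"
    using WhileT.IH(2)[OF 1(1-3)] by blast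
  ultimately show ?case using 0 unfolding append_assoc by (meson runs_within_trans)
next
  case (Read F s r u t)
  let ?i = "min (length w + 1) (0 + s r)"
  have "runs_within M w L (store_config (Run (Read r F # k)) i m s 0 v)
      (store_config (HomeInput (Seek r F k)) i m s 0 v)"
    using runs_within_quiet[of "Run (Read r F # k)" i m s 0 "HomeInput (Seek r F k)" Stay v]
      Read.prems by simp
  also have "runs_within M w L \<dots> (store_config (Seek r F k) 0 m s 0 v)"
    using Read.prems by (intro runs_within_home) auto
  also have seek: "fits m (s(r := 0)) \<and> runs_within M w L (store_config (Seek r F k) 0 m s 0 v)
      (store_config (Branch F k) ?i m (s(r := 0)) 0 v)"
    using Read.prems by (intro runs_within_seek) auto
  then have "runs_within M w L (store_config (Seek r F k) 0 m s 0 v)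
      (store_config (Branch F k) ?i m (s(r := 0)) 0 v)" ..
  also have "runs_within M w L \<dots> (store_config (Run (F (scanned_input w (s r)) # k)) ?i m (s(r := 0)) 0 v)"
    using runs_within_quiet[of "Branch F k" ?i m "s(r := 0)" 0 "Run (F (scanned_input w (s r)) # k)" Stay v]
      scanned_input_min[of "s r"] by simp
  finally have "runs_within M w L (store_config (Run (Read r F # k)) i m s 0 v)
      (store_config (Run (F (scanned_input w (s r)) # k)) ?i m (s(r := 0)) 0 v)" .
  moreover have "\<exists>i' m'. fits m' t \<and> m' \<le> L \<and> i' \<le> length w + 1 \<and>
      runs_within M w L (store_config (Run (F (scanned_input w (s r)) # k)) ?i m (s(r := 0)) 0 v)
        (store_config (Run k) i' m' t 0 (v @ u))"
    by (rule Read.IH[OF conjunct1[OF seek] Read.prems(2)]) simp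
  ultimately show ?case by (meson runs_within_trans)
qed

end

lemma compile_correct:
  fixes c :: "('x, 'y) com" and Q :: "('x, 'y) control set" and K :: nat
  assumes "exec B w c (\<lambda>_. 0) u t" "B \<le> 2 ^ L" "1 \<le> L"
  defines "M \<equiv> compile Q K c"
  shows "outputs M w u \<and> (\<forall>c'. reachable M w c' \<longrightarrow> work_pos c' \<le> L)"
proof -
  have M: "trans M = control_trans" by (simp add: M_def compile_def)
  let ?c1 = "store_config (Run [c]) 0 1 (\<lambda>_. 0) 0 []"
  have tape: "(\<lambda>_. {})(0 := {Visited, LeftMost}) = store_tape 1 (\<lambda>_. 0)"
    by (auto simp: store_tape_def fun_eq_iff)
  have "step M w (init_config M) ?c1"
    using tape by (simp add: step_def current_trans_def M init_config_def store_config_def)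
      (simp add: M_def compile_def)
  then have start: "runs_within M w L (init_config M) ?c1"
    unfolding runs_within_def by (intro r_into_rtranclp) (simp add: init_config_def store_config_def)
  have "fits 1 (\<lambda>_. 0)" by (simp add: fits_def)
  from runs_within_exec[OF M assms(1,2) this assms(3), of 0 "[]" "[]"]
  obtain i m where "runs_within M w L ?c1 (store_config (Run []) i m t 0 u)" by auto
  with start have run: "runs_within M w L (init_config M) (store_config (Run []) i m t 0 u)"
    by (rule runs_within_trans)
  have halt: "halted M w (store_config (Run []) i m t 0 u)"
    by (simp add: halted_def current_trans_def M store_config_def)
  have "reachable M w (store_config (Run []) i m t 0 u)"
    using run unfolding runs_within_def reachable_def by (rule rtranclp_mono[THEN predicate2D, rotated]) auto
  with halt have "outputs M w u"
    by (auto simp: outputs_def halted_def store_config_def)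
  moreover have "work_pos c' \<le> L" if "reachable M w c'" for c'
    using runs_within_reachable[OF run halt _ that[unfolded reachable_def]] by (simp add: store_config_def)
  ultimately show ?thesis by blast
qed

text \<open>
  Computability asks for numbers as states and work symbols, whereas the control states above contain
  programs and the squares hold sets. Only finitely many of them occur, so they can be renamed.
\<close>

definition rename_transducer ::
    "('q \<Rightarrow> nat) \<Rightarrow> ('g \<Rightarrow> nat) \<Rightarrow> ('q, 'g, 'x, 'y) transducer \<Rightarrow> (nat, nat, 'x, 'y) transducer" where
  "rename_transducer \<alpha> \<beta> M =
     \<lparr>states = \<alpha> ` states M, init = \<alpha> (init M), work_alphabet = \<beta> ` work_alphabet M,
      blank = \<beta> (blank M),
      trans = (\<lambda>q a g. map_option (\<lambda>(q', g', mi, mw, u). (\<alpha> q', \<beta> g', mi, mw, u))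
        (trans M (inv_into (states M) \<alpha> q) a (inv_into (work_alphabet M) \<beta> g)))\<rparr>"

definition rename_config ::
    "('q \<Rightarrow> nat) \<Rightarrow> ('g \<Rightarrow> nat) \<Rightarrow> ('q, 'g, 'y) config \<Rightarrow> (nat, nat, 'y) config" where
  "rename_config \<alpha> \<beta> c =
     \<lparr>state = \<alpha> (state c), input_pos = input_pos c, work_tape = \<beta> \<circ> work_tape c,
      work_pos = work_pos c, out_tape = out_tape c\<rparr>"

lemma wf_rename:
  assumes "wf_transducer X Y M" "inj_on \<alpha> (states M)" "inj_on \<beta> (work_alphabet M)"
  shows "wf_transducer X Y (rename_transducer \<alpha> \<beta> M)"
proof -
  from assms(1) obtain b where b: "\<And>q a g q' g' mi mw u. q \<in> states M \<Longrightarrow>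
      a \<in> {LeftEnd, RightEnd} \<union> Letter ` X \<Longrightarrow> g \<in> work_alphabet M \<Longrightarrow>
      trans M q a g = Some (q', g', mi, mw, u) \<Longrightarrow>
      q' \<in> states M \<and> g' \<in> work_alphabet M \<and> u \<in> lists Y \<and> length u \<le> b"
    unfolding wf_transducer_def by metis
  show ?thesis
    unfolding wf_transducer_def
  proof (intro conjI exI[of _ b] ballI allI impI)
    fix q a g q' g' mi mw u
    assume "q \<in> states (rename_transducer \<alpha> \<beta> M)" "a \<in> {LeftEnd, RightEnd} \<union> Letter ` X"
      "g \<in> work_alphabet (rename_transducer \<alpha> \<beta> M)"
      "trans (rename_transducer \<alpha> \<beta> M) q a g = Some (q', g', mi, mw, u)"
    moreover from this obtain p h p' h' where "q = \<alpha> p" "p \<in> states M" "g = \<beta> h" "h \<in> work_alphabet M"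
      "trans M p a h = Some (p', h', mi, mw, u)" "q' = \<alpha> p'" "g' = \<beta> h'"
      using assms(2,3) by (auto simp: rename_transducer_def)
    ultimately show "q' \<in> states (rename_transducer \<alpha> \<beta> M)"
      "g' \<in> work_alphabet (rename_transducer \<alpha> \<beta> M)" "u \<in> lists Y" "length u \<le> b"
      using b[of p a h p' h' mi mw u] by (auto simp: rename_transducer_def)
  qed (use assms(1) in \<open>auto simp: wf_transducer_def rename_transducer_def\<close>)
qed

lemma logspace_computableI:
  fixes M :: "('q, 'g, 'x, 'y) transducer"
  assumes M: "logspace_transducer X Y M" and S: "S \<subseteq> lists X" "f \<in> S \<rightarrow> lists Y"
    and out: "\<And>w. w \<in> S \<Longrightarrow> outputs M w (f w)"
  shows "logspace_computable X Y S f"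
proof -
  have wf: "wf_transducer X Y M" using M by (simp add: logspace_transducer_def)
  then obtain \<alpha> :: "'q \<Rightarrow> nat" and \<beta> :: "'g \<Rightarrow> nat"
    where inj: "inj_on \<alpha> (states M)" "inj_on \<beta> (work_alphabet M)"
    using finite_imp_inj_to_nat_seg unfolding wf_transducer_def by metis
  let ?M = "rename_transducer \<alpha> \<beta> M" and ?r = "rename_config \<alpha> \<beta> :: ('q, 'g, 'y) config \<Rightarrow> _"
  have cur: "current_trans ?M w (?r c) =
      map_option (\<lambda>(q', g', mi, mw, u). (\<alpha> q', \<beta> g', mi, mw, u)) (current_trans M w c)"
    if "w \<in> lists X" "reachable M w c" for w c
    using reachable_wf[OF wf that] inj
    by (simp add: current_trans_def rename_transducer_def rename_config_def)
  have init: "?r (init_config M) = init_config ?M"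
    by (simp add: rename_config_def rename_transducer_def init_config_def comp_def)
  have step_iff: "step ?M w (?r c) d' \<longleftrightarrow> (\<exists>d. step M w c d \<and> d' = ?r d)"
    if "w \<in> lists X" "reachable M w c" for w c d'
    unfolding step_def cur[OF that] by (fastforce simp: rename_config_def fun_upd_comp)
  have fwd: "reachable ?M w (?r c)" if "w \<in> lists X" "reachable M w c" for w c
    using that(2) unfolding reachable_def
  proof (induction rule: rtranclp_induct)
    case base
    then show ?case by (simp add: init)
  next
    case (step c d)
    then have "step ?M w (?r c) (?r d)"
      using step_iff[OF that(1)] unfolding reachable_def by blast
    with step.IH show ?case by (rule rtranclp.rtrancl_into_rtrancl)
  qed
  have bwd: "\<exists>c. reachable M w c \<and> c' = ?r c" if "w \<in> lists X" "reachable ?M w c'" for w c'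
    using that(2) unfolding reachable_def[of ?M]
  proof (induction rule: rtranclp_induct)
    case base
    then show ?case using init reachable_init by metis
  next
    case (step c' d')
    then show ?case using step_iff[OF that(1)] reachable_step by metis
  qed
  have "logspace_transducer X Y ?M"
  proof -
    from M obtain \<kappa> where \<kappa>: "\<And>w c. w \<in> lists X \<Longrightarrow> reachable M w c \<Longrightarrow>
        real (work_pos c + 1) \<le> \<kappa> * log 2 (real (length w + 2))"
      unfolding logspace_transducer_def by blast
    have "real (work_pos c' + 1) \<le> \<kappa> * log 2 (real (length w + 2))"
      if "w \<in> lists X" "reachable ?M w c'" for w c'
      using bwd[OF that] \<kappa>[OF that(1)] by (auto simp: rename_config_def)
    then show ?thesis
      using wf_rename[OF wf inj] unfolding logspace_transducer_def by blast
  qed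
  moreover have "outputs ?M w (f w)" if w: "w \<in> S" for w
  proof -
    have wX: "w \<in> lists X" using w S by blast
    from out[OF w] obtain c where c: "reachable M w c" "current_trans M w c = None" "out_tape c = f w"
      by (auto simp: outputs_def)
    have "current_trans ?M w (?r c) = None" "out_tape (?r c) = f w"
      using cur[OF wX c(1)] c by (simp_all add: rename_config_def)
    with fwd[OF wX c(1)] show ?thesis unfolding outputs_def by blast
  qed
  ultimately show ?thesis
    using wf S unfolding logspace_computable_def wf_transducer_def by blast
qed

text \<open>
  The program has to terminate on every word, since the space bound on a transducer concerns all
  words over the input alphabet.
\<close>

theorem while_imp_logspace_computable:
  assumes "while_computable X Y (lists X) f"
  shows "logspace_computable X Y (lists X) f"
proof -
  have fin: "finite X" "finite Y" and fY: "f \<in> lists X \<rightarrow> lists Y"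
    using assms by (simp_all add: while_computable_def)
  from assms obtain c K d where c: "wf_com X Y K c"
    and c_exec: "\<And>w. w \<in> lists X \<Longrightarrow> \<exists>t. exec ((length w + 2) ^ d) w c (\<lambda>_. 0) (f w) t"
    unfolding while_computable_def by blast
  let ?M = "compile (program_controls X c) K c"
  have main: "outputs ?M w (f w) \<and> (\<forall>c'. reachable ?M w c' \<longrightarrow>
      real (work_pos c' + 1) \<le> (real d + 3) * log 2 (real (length w + 2)))"
    if w: "w \<in> lists X" for w
  proof -
    define N where "N = real (length w + 2)"
    define L where "L = nat \<lceil>real d * log 2 N\<rceil> + 1"
    have log1: "1 \<le> log 2 N" by (simp add: N_def le_log_iff)
    have "N ^ d = 2 powr (real d * log 2 N)"
      by (simp add: N_def mult.commute[of "real d"] powr_powr[symmetric] powr_realpow)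
    also have "\<dots> \<le> 2 powr real L"
      unfolding L_def using real_nat_ceiling_ge[of "real d * log 2 N"] by (intro powr_mono) auto
    also have "\<dots> = 2 ^ L" by (rule powr_realpow) simp
    finally have "real ((length w + 2) ^ d) \<le> real (2 ^ L)" by (simp add: N_def)
    then have B: "(length w + 2) ^ d \<le> 2 ^ L" by (simp only: of_nat_le_iff)
    from c_exec[OF w] obtain t where t: "exec ((length w + 2) ^ d) w c (\<lambda>_. 0) (f w) t" ..
    have "0 \<le> real d * log 2 N" using log1 by simp
    then have "real L + 1 \<le> real d * log 2 N + 3" unfolding L_def by linarith
    also have "\<dots> \<le> (real d + 3) * log 2 N" using log1 by (simp add: algebra_simps)
    finally have "real L + 1 \<le> (real d + 3) * log 2 N" .
    then show ?thesis
      using compile_correct[OF t B, of "program_controls X c" K] unfolding N_def L_def[symmetric]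
      by (fastforce simp: L_def)
  qed
  have "logspace_transducer X Y ?M"
    unfolding logspace_transducer_def using wf_compile[OF fin c] main by blast
  then show ?thesis using fY main by (intro logspace_computableI) auto
qed

section \<open>Words in groups\<close>

lemma word_eval_Nil [simp]: "word_eval G [] = \<one>\<^bsub>G\<^esub>"
  by (simp add: word_eval_def)

lemma word_eval_Cons [simp]: "word_eval G (x # w) = x \<otimes>\<^bsub>G\<^esub> word_eval G w"
  by (simp add: word_eval_def)

lemma concat_map_in_lists:
  "w \<in> lists X \<Longrightarrow> (\<And>x. x \<in> X \<Longrightarrow> f x \<in> lists Y) \<Longrightarrow> concat (map f w) \<in> lists Y"
  by (induction w) auto

lemma concat_map_rev_in_lists:
  "w \<in> lists X \<Longrightarrow> (\<And>x. x \<in> X \<Longrightarrow> f x \<in> lists Y) \<Longrightarrow> concat (map f (rev w)) \<in> lists Y"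
  by (rule concat_map_in_lists[of _ X]) (simp_all add: in_lists_conv_set)

context group
begin

lemma word_eval_closed [simp]: "w \<in> lists (carrier G) \<Longrightarrow> word_eval G w \<in> carrier G"
  by (induction w) auto

lemma word_eval_append:
  "u \<in> lists (carrier G) \<Longrightarrow> v \<in> lists (carrier G) \<Longrightarrow>
    word_eval G (u @ v) = word_eval G u \<otimes> word_eval G v"
  by (induction u) (auto simp: m_assoc)

lemma word_eval_inverse:
  "w \<in> lists (carrier G) \<Longrightarrow> word_eval G (rev (map (\<lambda>x. inv x) w)) = inv (word_eval G w)"
proof (induction w)
  case (Cons x w)
  then have "rev (map (\<lambda>x. inv x) w) \<in> lists (carrier G)" by auto
  with Cons show ?case by (simp add: word_eval_append inv_mult_group)
qed simp

lemma word_eval_reverse_hom: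
  assumes "\<And>y. y \<in> Y \<Longrightarrow> s y \<in> lists (carrier G)" "\<And>y. y \<in> Y \<Longrightarrow> r y \<in> lists (carrier G)"
    and "\<And>y. y \<in> Y \<Longrightarrow> word_eval G (r y) = inv (word_eval G (s y))"
  shows "v \<in> lists Y \<Longrightarrow>
    word_eval G (concat (map r (rev v))) = inv (word_eval G (concat (map s v)))"
proof (induction v)
  case (Cons y v)
  then have "concat (map r (rev v)) \<in> lists (carrier G)" "concat (map s v) \<in> lists (carrier G)"
    using concat_map_rev_in_lists[of v Y r] concat_map_in_lists[of v Y s] assms(1,2) by simp_all
  with Cons assms show ?case
    by (simp add: word_eval_append inv_mult_group)
qed simp

lemma word_eval_hom:
  assumes H: "group H" "h \<in> hom G H" and X: "X \<subseteq> carrier G"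
    and f: "\<And>x. x \<in> X \<Longrightarrow> f x \<in> lists (carrier H)" "\<And>x. x \<in> X \<Longrightarrow> word_eval H (f x) = h x"
  shows "w \<in> lists X \<Longrightarrow> word_eval H (concat (map f w)) = h (word_eval G w)"
proof (induction w)
  case Nil
  then show ?case using hom_one[OF H(2) group_axioms H(1)] by simp
next
  case (Cons x w)
  then have "concat (map f w) \<in> lists (carrier H)"
    using f(1) concat_map_in_lists[of w X f] by simp
  moreover have "word_eval G w \<in> carrier G" "x \<in> carrier G"
    using Cons.prems X by (auto intro!: word_eval_closed)
  ultimately show ?case
    using Cons f by (simp add: group.word_eval_append[OF H(1)] hom_mult[OF H(2)])
qed

lemma hom_word_eval_lift:
  assumes H: "group H" "h \<in> hom G H"
    and s: "\<And>y. y \<in> Y \<Longrightarrow> s y \<in> lists (carrier G)" "\<And>y. y \<in> Y \<Longrightarrow> h (word_eval G (s y)) = y"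
  shows "v \<in> lists Y \<Longrightarrow> h (word_eval G (concat (map s v))) = word_eval H v"
proof (induction v)
  case Nil
  then show ?case using hom_one[OF H(2) group_axioms H(1)] by simp
next
  case (Cons y v)
  then have "concat (map s v) \<in> lists (carrier G)"
    using s(1) concat_map_in_lists[of v Y s] by simp
  with Cons s show ?case by (simp add: word_eval_append hom_mult[OF H(2)])
qed

lemma generated_by_words:
  assumes "finite_symmetric_generating_set G X" "g \<in> carrier G"
  shows "\<exists>w \<in> lists X. word_eval G w = g"
proof -
  have X: "X \<subseteq> carrier G" "\<And>x. x \<in> X \<Longrightarrow> inv x \<in> X"
    using assms(1) by (auto simp: finite_symmetric_generating_set_def)
  have "g \<in> generate G X" using assms by (simp add: finite_symmetric_generating_set_def)
  then show ?thesis
  proof induction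
    case one
    show ?case by (intro bexI[of _ "[]"]) auto
  next
    case (incl x)
    then show ?case using X by (intro bexI[of _ "[x]"]) auto
  next
    case (inv x)
    then show ?case using X by (intro bexI[of _ "[inv x]"]) auto
  next
    case (eng g h)
    then obtain u v where uv: "u \<in> lists X" "v \<in> lists X" "word_eval G u = g" "word_eval G v = h" by blast
    then have "u \<in> lists (carrier G)" "v \<in> lists (carrier G)" using X(1) by auto
    then have "word_eval G (u @ v) = g \<otimes> h" using uv by (simp add: word_eval_append)
    then show ?case using uv(1,2) by (intro bexI[of _ "u @ v"]) auto
  qed
qed

lemma same_coset_mult_inv:
  assumes "subgroup N G" "a \<in> carrier G" "b \<in> carrier G" "N #> a = N #> b"
  shows "a \<otimes> inv b \<in> N"
proof -
  have "a \<in> N #> b" using rcos_self[OF assms(2,1)] assms(4) by simp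
  then obtain n where n: "n \<in> N" "a = n \<otimes> b" by (auto simp: r_coset_def)
  moreover have "n \<in> carrier G" using n(1) assms(1) by (rule subgroup.mem_carrier[rotated])
  ultimately show ?thesis using assms(3) by (simp add: m_assoc)
qed

end

text \<open>
  The range of a function that picks one word for each element is a normal form.
\<close>

lemma normal_form_functionI:
  assumes "logspace_computable X X (lists X) g"
    and "\<And>w. w \<in> lists X \<Longrightarrow> word_eval G (g w) = word_eval G w"
    and "\<And>v w. v \<in> lists X \<Longrightarrow> w \<in> lists X \<Longrightarrow> word_eval G v = word_eval G w \<Longrightarrow> g v = g w"
    and "word_eval G ` lists X = carrier G"
  shows "logspace_normal_form_function G X g"
proof -
  have gX: "g w \<in> lists X" if "w \<in> lists X" for w
    using assms(1) that unfolding logspace_computable_def by blast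
  have "word_eval G ` g ` lists X = carrier G"
    using assms(2,4) by (simp add: image_image cong: image_cong_simp)
  moreover have "inj_on (word_eval G) (g ` lists X)"
  proof (rule inj_onI)
    fix a b assume "a \<in> g ` lists X" "b \<in> g ` lists X" and eq: "word_eval G a = word_eval G b"
    then obtain v w where "v \<in> lists X" "w \<in> lists X" "a = g v" "b = g w" by blast
    then show "a = b" using assms(2)[of v] assms(2)[of w] assms(3)[of v w] eq by simp
  qed
  ultimately have "normal_form G X (g ` lists X)"
    using gX unfolding normal_form_def bij_betw_def by blast
  then show ?thesis
    using assms(1,2) unfolding logspace_normal_form_function_def by blast
qed

theorem lemma30:
  fixes G :: "('a, 'b) monoid_scheme" and N X :: "'a set" and S :: "'a list set"
  assumes "group G"
    and "N \<lhd> G"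
    and "finite_symmetric_generating_set G X"
    and "S = {w \<in> lists X. word_eval G w \<in> N}"
    and "has_logspace_normal_form (G Mod N)"
    and "\<exists>f. f \<in> S \<rightarrow> S \<and> logspace_computable X X S f \<and>
           (\<forall>w \<in> S. word_eval G (f w) = word_eval G w) \<and>
           (\<forall>w1 \<in> S. \<forall>w2 \<in> S. f w1 = f w2 \<longleftrightarrow> word_eval G w1 = word_eval G w2)"
  shows "has_logspace_normal_form G"
proof -
  interpret G: group G by fact
  interpret N: normal N G by fact
  let ?Q = "G Mod N"
  let ?\<pi> = "\<lambda>g. N #>\<^bsub>G\<^esub> g"
  have Q: "group ?Q" by (rule N.factorgroup_is_group)
  have \<pi>: "?\<pi> \<in> hom G ?Q" by (rule N.r_coset_hom_Mod)
  from assms(3) have X: "finite X" "X \<subseteq> carrier G" "\<And>x. x \<in> X \<Longrightarrow> inv\<^bsub>G\<^esub> x \<in> X"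
    by (auto simp: finite_symmetric_generating_set_def)
  then have XG: "w \<in> lists (carrier G)" if "w \<in> lists X" for w using that by auto
  from assms(5) obtain Y q where Y: "finite_symmetric_generating_set ?Q Y"
    and q: "logspace_normal_form_function ?Q Y q"
    unfolding has_logspace_normal_form_def by blast
  have Y': "finite Y" "Y \<subseteq> carrier ?Q" using Y by (auto simp: finite_symmetric_generating_set_def)
  from q obtain L where q_comp: "logspace_computable Y Y (lists Y) q"
    and L: "normal_form ?Q Y L"
    and qL: "\<And>v. v \<in> lists Y \<Longrightarrow> q v \<in> L \<and> word_eval ?Q (q v) = word_eval ?Q v"
    unfolding logspace_normal_form_function_def by blast
  have qY: "q v \<in> lists Y" if "v \<in> lists Y" for v
    using q_comp that unfolding logspace_computable_def by blast
  have q_cong: "q u = q v" if "u \<in> lists Y" "v \<in> lists Y" "word_eval ?Q u = word_eval ?Q v" for u v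
    using L qL[OF that(1)] qL[OF that(2)] that(3)
    unfolding normal_form_def bij_betw_def by (metis inj_onD)
  from assms(6) obtain f where fS: "\<And>w. w \<in> S \<Longrightarrow> f w \<in> S"
    and f_comp: "logspace_computable X X S f"
    and f_eval: "\<And>w. w \<in> S \<Longrightarrow> word_eval G (f w) = word_eval G w"
    and f_cong: "\<And>v w. v \<in> S \<Longrightarrow> w \<in> S \<Longrightarrow> word_eval G v = word_eval G w \<Longrightarrow> f v = f w"
    by blast
  have SX: "w \<in> lists X" if "w \<in> S" for w using that assms(4) by simp

  \<comment> \<open>the translations \<open>\<phi>\<close> from \<open>X\<close> to \<open>Y\<close> and \<open>\<sigma>\<close> back, and \<open>\<rho>\<close> for formal inverses of translations back\<close>
  have "\<exists>v \<in> lists Y. word_eval ?Q v = ?\<pi> x" if "x \<in> X" for x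
    using group.generated_by_words[OF Q Y] \<pi> X(2) that by (auto simp: hom_def)
  then obtain \<phi> where \<phi>: "\<And>x. x \<in> X \<Longrightarrow> \<phi> x \<in> lists Y" "\<And>x. x \<in> X \<Longrightarrow> word_eval ?Q (\<phi> x) = ?\<pi> x"
    by metis
  have "\<exists>u \<in> lists X. ?\<pi> (word_eval G u) = y" if "y \<in> Y" for y
  proof -
    obtain g where "g \<in> carrier G" "y = ?\<pi> g"
      using Y'(2) \<open>y \<in> Y\<close> by (auto simp: FactGroup_def RCOSETS_def)
    then show ?thesis using G.generated_by_words[OF assms(3)] by metis
  qed
  then obtain \<sigma> where \<sigma>: "\<And>y. y \<in> Y \<Longrightarrow> \<sigma> y \<in> lists X" "\<And>y. y \<in> Y \<Longrightarrow> ?\<pi> (word_eval G (\<sigma> y)) = y"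
    by metis
  define \<rho> where "\<rho> y = rev (map (\<lambda>x. inv\<^bsub>G\<^esub> x) (\<sigma> y))" for y
  have \<rho>: "\<rho> y \<in> lists X" "word_eval G (\<rho> y) = inv\<^bsub>G\<^esub> (word_eval G (\<sigma> y))" if "y \<in> Y" for y
    using \<sigma>(1)[OF that] X(3) G.word_eval_inverse[OF XG[OF \<sigma>(1)[OF that]]]
    by (auto simp: \<rho>_def)

  define h where "h w = q (concat (map \<phi> w))" for w
  define t where "t w = concat (map \<sigma> (h w))" for w
  define t' where "t' w = concat (map \<rho> (rev (h w)))" for w
  define g where "g w = f (concat (map (\<lambda>x. [x]) w) @ t' w) @ t w" for w
  \<comment> \<open>writing \<open>w\<close> as its image under the identity makes its computability visible\<close>
  have id: "concat (map (\<lambda>x. [x]) w) = w" for w :: "'a list" by (induction w) auto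

  have \<phi>Y: "concat (map \<phi> w) \<in> lists Y" if "w \<in> lists X" for w
    using that \<phi>(1) by (rule concat_map_in_lists)
  have hY: "h w \<in> lists Y" if "w \<in> lists X" for w
    unfolding h_def using qY \<phi>Y that by blast
  have tX: "t w \<in> lists X" if "w \<in> lists X" for w
    unfolding t_def using hY[OF that] \<sigma>(1) by (rule concat_map_in_lists)
  have t'X: "t' w \<in> lists X" if "w \<in> lists X" for w
    unfolding t'_def using hY[OF that] \<rho>(1) by (rule concat_map_rev_in_lists)
  have \<phi>_eval: "word_eval ?Q (concat (map \<phi> w)) = ?\<pi> (word_eval G w)" if "w \<in> lists X" for w
    using lists_mono[OF Y'(2)] \<phi> that by (intro G.word_eval_hom[OF Q \<pi> X(2)]) (blast | simp)+
  have t'_eval: "word_eval G (t' w) = inv\<^bsub>G\<^esub> (word_eval G (t w))" if "w \<in> lists X" for w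
    unfolding t'_def t_def
    by (rule G.word_eval_reverse_hom[OF XG[OF \<sigma>(1)] XG[OF \<rho>(1)] \<rho>(2) hY[OF that]])
  have \<sigma>_eval: "?\<pi> (word_eval G (concat (map \<sigma> v))) = word_eval ?Q v" if "v \<in> lists Y" for v
    by (rule G.hom_word_eval_lift[OF Q \<pi> XG[OF \<sigma>(1)] \<sigma>(2) that])
  have t_eval: "?\<pi> (word_eval G (t w)) = ?\<pi> (word_eval G w)" if "w \<in> lists X" for w
    unfolding t_def using \<sigma>_eval[OF hY[OF that]] qL[OF \<phi>Y[OF that]] \<phi>_eval[OF that]
    by (simp add: h_def)

  have corrected: "w @ t' w \<in> S"
    "word_eval G (w @ t' w) = word_eval G w \<otimes>\<^bsub>G\<^esub> inv\<^bsub>G\<^esub> (word_eval G (t w))" if w: "w \<in> lists X" for w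
  proof -
    show eval: "word_eval G (w @ t' w) = word_eval G w \<otimes>\<^bsub>G\<^esub> inv\<^bsub>G\<^esub> (word_eval G (t w))"
      using XG[OF w] XG[OF t'X[OF w]] t'_eval[OF w] by (simp add: G.word_eval_append)
    have "word_eval G w \<otimes>\<^bsub>G\<^esub> inv\<^bsub>G\<^esub> (word_eval G (t w)) \<in> N"
      using XG[OF w] XG[OF tX[OF w]] t_eval[OF w]
      by (intro G.same_coset_mult_inv[OF N.subgroup_axioms]) simp_all
    then show "w @ t' w \<in> S" using eval w t'X[OF w] assms(4) by simp
  qed

  have g_eval: "word_eval G (g w) = word_eval G w" if w: "w \<in> lists X" for w
  proof -
    have "word_eval G (g w) = word_eval G (f (w @ t' w)) \<otimes>\<^bsub>G\<^esub> word_eval G (t w)"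
      unfolding g_def id
      by (intro G.word_eval_append XG tX[OF w] SX fS corrected(1)[OF w])
    then show ?thesis
      using f_eval[OF corrected(1)[OF w]] corrected(2)[OF w] XG[OF w] XG[OF tX[OF w]]
      by (simp add: G.m_assoc)
  qed
  have g_cong: "g v = g w"
    if v: "v \<in> lists X" and w: "w \<in> lists X" and eq: "word_eval G v = word_eval G w" for v w
  proof -
    have "h v = h w"
      unfolding h_def using \<phi>_eval[OF v] \<phi>_eval[OF w] eq by (intro q_cong \<phi>Y v w) simp
    then have "t v = t w" "t' v = t' w" by (simp_all add: t_def t'_def)
    moreover have "f (v @ t' v) = f (w @ t' w)"
      using corrected[OF v] corrected[OF w] eq \<open>t v = t w\<close> by (intro f_cong) simp_all
    ultimately show ?thesis unfolding g_def id by simp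
  qed

  have h_comp: "while_computable X Y (lists X) h"
    unfolding h_def
    by (rule while_computable_comp[OF while_computable_hom[OF X(1) Y'(1) \<phi>(1)]
          logspace_imp_while_computable[OF q_comp] \<phi>Y])
  have "while_computable X X (lists X) (\<lambda>w. concat (map (\<lambda>x. [x]) w) @ t' w)"
    unfolding t'_def
    by (intro while_computable_append while_computable_hom X(1)
          while_computable_comp[OF h_comp while_computable_reverse_hom[OF Y'(1) X(1) \<rho>(1)] hY]) auto
  then have "while_computable X X (lists X) (\<lambda>w. f (concat (map (\<lambda>x. [x]) w) @ t' w))"
    using logspace_imp_while_computable[OF f_comp]
    by (rule while_computable_comp) (simp add: id corrected(1))
  moreover have "while_computable X X (lists X) t"
    unfolding t_def by (rule while_computable_comp[OF h_comp while_computable_hom[OF Y'(1) X(1) \<sigma>(1)] hY])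
  ultimately have "while_computable X X (lists X) g"
    unfolding g_def by (rule while_computable_append)
  then have "logspace_computable X X (lists X) g" by (rule while_imp_logspace_computable)
  moreover have "word_eval G ` lists X = carrier G"
    using G.generated_by_words[OF assms(3)] G.word_eval_closed[OF XG] by blast
  ultimately have "logspace_normal_form_function G X g"
    using g_eval g_cong by (intro normal_form_functionI)
  then show ?thesis using assms(3) unfolding has_logspace_normal_form_def by blast
qed

end
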